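(* Let $M,N\ge 1$ be integers. Let $V\subset\mathfrak{X}$ be a linear subspace, and let $\nu$ be a quadrature measure for $V$ on $\mathbb{W}$ with finite support $\mathsf{supp}(\nu)=\{w_1,\dots,w_N\}$. Let $|||G|||$ and $\epsilon(V)$ be finite constants such that $$\sup_{x\in\mathbb{X}}\|G(\cdot,x)\|\le |||G|||,\qquad \sup_{x\in\mathbb{X}}\mathsf{dist}(G(\cdot,x),V)\le \epsilon(V).$$ Let $x_1,\dots,x_M\in\mathbb{X}$, $\mathbb{K}=[K(x_k,x_j)]_{k,j=1}^M$ and $\widehat{\mathbb{K}}=[K(\nu;x_k,x_j)]_{k,j=1}^M$. Let $\sigma_1\ge\cdots\ge\sigma_M$ and $\tau_1\ge\cdots\ge\tau_M$ be the eigenvalues of $\mathbb{K}$ and $\widehat{\mathbb{K}}$ respectively. Put $$\varepsilon=4(1+|\nu|)\,M\,|||G|||\,\epsilon(V).$$ Then $$\max_{1\le j\le M}|\sigma_j-\tau_j|\le\varepsilon .$$ In particular, the spectral norm of $\mathbb{K}-\widehat{\mathbb{K}}$ is $\le\varepsilon$. For every $\Lambda\ge\varepsilon$, $$\mathbb{K}-\Lambda\mathbb{I}\ll\widehat{\mathbb{K}}\ll\mathbb{K}+\Lambda\mathbb{I},$$ where $\mathbb{I}$ is the $M\times M$ identity matrix. For every $\lambda>0$ and every $\Delta\ge\varepsilon/(\lambda+\sigma_M)$, $$(1-\Delta)(\mathbb{K}+\lambda\mathbb{I})\ll\widehat{\mathbb{K}}+\lambda\mathbb{I}\ll(1+\D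elta)(\mathbb{K}+\lambda\mathbb{I}).$$
   Context: $\mathbb{W}$ is a topological space, $\mu^*$ is a $\sigma$-finite (positive) Borel measure on $\mathbb{W}$, and $\mathbb{X}$ is a nonempty set. $C_0(\mathbb{W})$ is the space of continuous complex-valued functions on $\mathbb{W}$ vanishing at infinity. Set $\mathfrak{X}=L^1(\mu^* )\cap C_0(\mathbb{W})$, with norm $$\|f\|=\max(\|f\|_1,\|f\|_\infty),\qquad \|f\|_1=\int_{\mathbb{W}}|f|\,d\mu^*,\qquad \|f\|_\infty=\sup_{w\in\mathbb{W}}|f(w)|.$$ For a linear subspace $V\subset\mathfrak{X}$ and $f\in\mathfrak{X}$, $\mathsf{dist}(f,V)=\inf_{P\in V}\|f-P\|$. $G:\mathbb{W}\times\mathbb{X}\to\mathbb{C}$ is a given function such that $G(\cdot,x)$ is $\mu^*$-measurable for every $x\in\mathbb{X}$ and the family $\mathcal{F}=\{G(\cdot,x):x\in\mathbb{X}\}$ is contained in $\mathfrak{X}$ and compact in $\mathfrak{X}$. The kernel $K$ is defined by $$K(x,y)=K(\mu^*;x,y)=\int_{\mathbb{W}}G(w,x)\overline{G(w,y)}\,d\mu^*(w),\qquad x,y\in\mathbb{X},$$ and, for a finitely supported real (possibly signed) measure $\nu$ on $\mathbb{W}$, $$K(\nu;x,y)=\int_{\mathbb{W}}G(w,x)\overline{G(w,y)}\,d\nu(w),\qquad x,y\in\mathbb{X}.$$ A (possibly signed) measure $\nu$ on $\mathbb{W}$ is called a (product) quadrature measure for $V$ if it has finite total variation, denoted (as a number)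 by $|\nu|$, and $$\int_{\mathbb{W}}|P|^2\,d\nu=\int_{\mathbb{W}}|P|^2\,d\mu^*\quad\text{for all }P\in V,$$ equivalently $\int_{\mathbb{W}}P\overline{Q}\,d\nu=\int_{\mathbb{W}}P\overline{Q}\,d\mu^*$ for all $P,Q\in V$. For symmetric (Hermitian, in the complex case) matrices $A,B$ of the same size, $A\ll B$ means that $B-A$ is positive semi-definite. *)

theory Defs
  imports
    "HOL-Analysis.Analysis"
    "HOL-Library.Function_Algebras"
    "HOL-Library.Disjoint_Sets"
    "Jordan_Normal_Form.Char_Poly"
    "Jordan_Normal_Form.Schur_Decomposition"
begin

section \<open>The space of integrable continuous functions vanishing at infinity\<close>

definition vanishes_at_infinity :: "('w::topological_space \<Rightarrow> complex) \<Rightarrow> bool" where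
  "vanishes_at_infinity f \<longleftrightarrow> (\<forall>e>0. compact {w. e \<le> cmod (f w)})"

definition C0_space :: "('w::topological_space \<Rightarrow> complex) set" where
  "C0_space = {f. continuous_on UNIV f \<and> vanishes_at_infinity f}"

definition L1C0_space :: "'w::topological_space measure \<Rightarrow> ('w \<Rightarrow> complex) set" where
  "L1C0_space \<mu> = {f. integrable \<mu> f} \<inter> C0_space"

text \<open>The supremum is a supremum of real numbers; it is meaningful because every element of
  \<^const>\<open>C0_space\<close> is bounded.\<close>

definition L1C0_norm :: "'w measure \<Rightarrow> ('w \<Rightarrow> complex) \<Rightarrow> real" where
  "L1C0_norm \<mu> f = max (LINT w|\<mu>. cmod (f w)) (SUP w. cmod (f w))"

definition L1C0_dist :: "'w measure \<Rightarrow> ('w \<Rightarrow> complex) \<Rightarrow> ('w \<Rightarrow> complex) \<Rightarrow> real" where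
  "L1C0_dist \<mu> f g = L1C0_norm \<mu> (\<lambda>w. f w - g w)"

definition L1C0_topology :: "'w::topological_space measure \<Rightarrow> ('w \<Rightarrow> complex) topology" where
  "L1C0_topology \<mu> = Metric_space.mtopology (L1C0_space \<mu>) (L1C0_dist \<mu>)"

definition L1C0_setdist :: "'w measure \<Rightarrow> ('w \<Rightarrow> complex) \<Rightarrow> ('w \<Rightarrow> complex) set \<Rightarrow> real" where
  "L1C0_setdist \<mu> f V = (INF P\<in>V. L1C0_dist \<mu> f P)"

definition complex_fun_subspace :: "('w \<Rightarrow> complex) set \<Rightarrow> bool" where
  "complex_fun_subspace V \<longleftrightarrow> Modules.module.subspace (\<lambda>c f w. c * f w) V"


section \<open>Signed Borel measures\<close>

text \<open>A signed measure is a countably additive real set function; only its values on Borel sets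
  matter. Since the values are real, infinite masses are excluded.\<close>

definition signed_borel_measure :: "('w::topological_space set \<Rightarrow> real) \<Rightarrow> bool" where
  "signed_borel_measure \<nu> \<longleftrightarrow> \<nu> {} = 0 \<and>
     (\<forall>A::nat \<Rightarrow> 'w set. range A \<subseteq> sets borel \<longrightarrow> disjoint_family A \<longrightarrow>
        (\<lambda>i. \<nu> (A i)) sums \<nu> (\<Union>i. A i))"

definition variation :: "('w::topological_space set \<Rightarrow> real) \<Rightarrow> 'w set \<Rightarrow> ennreal" where
  "variation \<nu> A =
     (SUP \<P>\<in>{\<P>. finite \<P> \<and> \<P> \<subseteq> sets borel \<and> partition_on A \<P>}. \<Sum>B\<in>\<P>. ennreal \<bar>\<nu> B\<bar>)"

definition total_variation :: "('w::topological_space set \<Rightarrow> real) \<Rightarrow> real" where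
  "total_variation \<nu> = enn2real (variation \<nu> UNIV)"

definition signed_support :: "('w::topological_space set \<Rightarrow> real) \<Rightarrow> 'w set" where
  "signed_support \<nu> = {w. \<forall>U. open U \<longrightarrow> w \<in> U \<longrightarrow> 0 < variation \<nu> U}"

text \<open>The positive part of the Jordan decomposition, \<open>\<nu>\<^sup>+(A) = sup {\<nu>(B) | B \<subseteq> A}\<close>, as a
  measure. Here \<^const>\<open>ennreal\<close> maps negative reals to 0, which does not change the supremum
  because \<open>B = {}\<close> is admitted. The negative part is the positive part of \<open>-\<nu>\<close>.\<close>

definition positive_part :: "('w::topological_space set \<Rightarrow> real) \<Rightarrow> 'w measure" where
  "positive_part \<nu> =
     measure_of UNIV (sets borel) (\<lambda>A. SUP B\<in>{B\<in>sets borel. B \<subseteq> A}. ennreal (\<nu> B))"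

definition negative_part :: "('w::topological_space set \<Rightarrow> real) \<Rightarrow> 'w measure" where
  "negative_part \<nu> = positive_part (\<lambda>A. - \<nu> A)"

definition signed_integral ::
    "('w::topological_space set \<Rightarrow> real) \<Rightarrow> ('w \<Rightarrow> 'b::{banach, second_countable_topology}) \<Rightarrow> 'b"
  where "signed_integral \<nu> f =
     integral\<^sup>L (positive_part \<nu>) f - integral\<^sup>L (negative_part \<nu>) f"

definition quadrature_measure ::
    "'w::topological_space measure \<Rightarrow> ('w \<Rightarrow> complex) set \<Rightarrow> ('w set \<Rightarrow> real) \<Rightarrow> bool" where
  "quadrature_measure \<mu> V \<nu> \<longleftrightarrow>
     signed_borel_measure \<nu> \<and> variation \<nu> UNIV < \<infinity> \<and>
     (\<forall>P\<in>V. signed_integral \<nu> (\<lambda>w. (cmod (P w))\<^sup>2) = (LINT w|\<mu>. (cmod (P w))\<^sup>2))"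


section \<open>Kernels\<close>

definition integral_kernel :: "'w measure \<Rightarrow> ('w \<Rightarrow> 'x \<Rightarrow> complex) \<Rightarrow> 'x \<Rightarrow> 'x \<Rightarrow> complex" where
  "integral_kernel \<mu> G x y = (LINT w|\<mu>. G w x * cnj (G w y))"

definition signed_kernel ::
    "('w::topological_space set \<Rightarrow> real) \<Rightarrow> ('w \<Rightarrow> 'x \<Rightarrow> complex) \<Rightarrow> 'x \<Rightarrow> 'x \<Rightarrow> complex" where
  "signed_kernel \<nu> G x y = signed_integral \<nu> (\<lambda>w. G w x * cnj (G w y))"


section \<open>Hermitian matrices\<close>

definition hermitian_mat :: "complex mat \<Rightarrow> bool" where
  "hermitian_mat A \<longleftrightarrow> square_mat A \<and> mat_adjoint A = A"

definition pos_semidef :: "complex mat \<Rightarrow> bool" where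
  "pos_semidef A \<longleftrightarrow> hermitian_mat A \<and>
     (\<forall>v\<in>carrier_vec (dim_row A). 0 \<le> Re ((A *\<^sub>v v) \<bullet>c v))"

definition loewner_le :: "complex mat \<Rightarrow> complex mat \<Rightarrow> bool" (infix \<open>\<lless>\<close> 50) where
  "A \<lless> B \<longleftrightarrow> hermitian_mat A \<and> hermitian_mat B \<and> dim_row A = dim_row B \<and> pos_semidef (B - A)"

text \<open>The eigenvalues in decreasing order, repeated according to their multiplicity as roots of the
  characteristic polynomial. This is meant for Hermitian matrices, whose eigenvalues are real, so
  that \<^const>\<open>Re\<close> only changes the type.\<close>

definition ordered_eigenvalues :: "complex mat \<Rightarrow> real list" where
  "ordered_eigenvalues A = rev (sorted_list_of_multiset (image_mset Re (proots (char_poly A))))"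

definition euclidean_norm_vec :: "complex vec \<Rightarrow> real" where
  "euclidean_norm_vec v = sqrt (Re (v \<bullet>c v))"

definition spectral_norm :: "complex mat \<Rightarrow> real" where
  "spectral_norm A =
     (SUP v\<in>{v \<in> carrier_vec (dim_col A). euclidean_norm_vec v = 1}. euclidean_norm_vec (A *\<^sub>v v))"

end

theory Submission
  imports Defs
begin

text \<open>For \<open>f, g\<close> in the compact family choose \<open>P, Q \<in> V\<close> almost realising the distances to \<open>V\<close>. The
  quadrature identity, polarised, makes the integrals of \<open>P Q\<^sup>*\<close> against \<open>\<mu>\<close> and \<open>\<nu>\<close> agree, so
  \<open>f g\<^sup>* - P Q\<^sup>* = (f - P) g\<^sup>* + P (g - Q)\<^sup>*\<close>, estimated in \<open>L\<^sup>1(\<mu>)\<close> and in the supremum norm, bounds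
  every entry of \<open>KK - KKhat\<close> by \<open>3 (1 + |\<nu>|) normG epsV\<close>. A matrix with entries bounded by \<open>c\<close> has
  quadratic form bounded by \<open>M c |v|\<^sup>2\<close>; the eigenvalue estimate is then Weyl's inequality, and the
  relative estimate uses that \<open>KK\<close> is a Gram matrix whose form is at least \<open>\<sigma>\<^sub>M |v|\<^sup>2\<close>. Integrals
  against \<open>\<nu>\<close> are controlled by \<open>|\<nu>|\<close> through its Jordan decomposition.\<close>

text \<open>The maximum in the norm lets one distance serve both measures. Against \<mu>, whose mass
  may be infinite, the small factor is integrated and the other one is bounded in the supremum norm;
  against \<nu>, a supremum bound is multiplied by the mass. These two errors add up to the factor 1
  + |\<nu>|. The 3 counts one term from f - P, paired with g, and two from g - Q, paired with P,
  whose supremum can only be held near 2 \<open>normG\<close>; the 4 in \<open>eps\<close> leaves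
  slack. As \<nu> may be signed, \<open>KKhat\<close> may fail to be positive semidefinite. The
  eigenvalue and Loewner bounds therefore all come from one two-sided inequality between quadratic
  forms, and positivity is used for \<open>KK\<close> alone, where it keeps the denominator lam +
  \<sigma>_M positive. A signed measure is here a bare set function, so its positive part has to be
  shown to be a measure. This is done without a Hahn set, by working with the suprema
  directly.\<close>

unbundle no vec_syntax

section \<open>The spectral theorem and Weyl's inequality\<close>

lemma index_mat_adjoint [simp]:
  assumes "i < dim_col A" "j < dim_row A"
  shows "mat_adjoint A $$ (i, j) = conjugate (A $$ (j, i))"
  using assms by (simp add: mat_adjoint_def mat_of_rows_def)

lemma dim_mat_adjoint [simp]:
  "dim_row (mat_adjoint A) = dim_col A" "dim_col (mat_adjoint A) = dim_row A"
  by (simp_all add: mat_adjoint_def)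

lemma mat_adjoint_carrier [simp, intro]: "A \<in> carrier_mat m n \<Longrightarrow> mat_adjoint A \<in> carrier_mat n m"
  by (auto intro!: carrier_matI)

lemma mat_adjoint_mult:
  fixes A B :: "complex mat"
  assumes "A \<in> carrier_mat m n" "B \<in> carrier_mat n k"
  shows "mat_adjoint (A * B) = mat_adjoint B * mat_adjoint A"
  using assms by (intro eq_matI) (auto simp: scalar_prod_def mult.commute)

lemma mat_adjoint_adjoint [simp]: "mat_adjoint (mat_adjoint (A :: complex mat)) = A"
  by (intro eq_matI) auto

lemma mat_adjoint_four_block:
  fixes A :: "complex mat"
  assumes "A \<in> carrier_mat n1 m1" "B \<in> carrier_mat n1 m2" "C \<in> carrier_mat n2 m1" "D \<in> carrier_mat n2 m2"
  shows "mat_adjoint (four_block_mat A B C D) =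
    four_block_mat (mat_adjoint A) (mat_adjoint C) (mat_adjoint B) (mat_adjoint D)"
  using assms by (intro eq_matI) (auto simp: less_diff_conv2)

lemma hermitian_matI:
  assumes "A \<in> carrier_mat n n" "\<And>i j. i < n \<Longrightarrow> j < n \<Longrightarrow> A $$ (i, j) = cnj (A $$ (j, i))"
  shows "hermitian_mat A"
proof -
  have "mat_adjoint A = A"
  proof (rule eq_matI)
    fix i j assume "i < dim_row A" "j < dim_col A"
    then have "i < n" "j < n" using assms(1) by auto
    from assms(2)[OF this] show "mat_adjoint A $$ (i, j) = A $$ (i, j)"
      using \<open>i < n\<close> \<open>j < n\<close> assms(1) by simp
  qed (use assms(1) in auto)
  then show ?thesis using assms(1) by (auto simp: hermitian_mat_def)
qed

lemma hermitian_matD: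
  assumes "hermitian_mat A" "A \<in> carrier_mat n n" "i < n" "j < n"
  shows "A $$ (i, j) = cnj (A $$ (j, i))"
proof -
  have "A $$ (i, j) = mat_adjoint A $$ (i, j)" using assms by (simp add: hermitian_mat_def)
  then show ?thesis using assms by auto
qed

lemma quadratic_form_sum:
  fixes A :: "complex mat"
  assumes "A \<in> carrier_mat n n" "v \<in> carrier_vec n"
  shows "(A *\<^sub>v v) \<bullet>c v = (\<Sum>i<n. \<Sum>j<n. A $$ (i, j) * v $ j * cnj (v $ i))"
proof -
  have "(A *\<^sub>v v) \<bullet>c v = (\<Sum>i<n. (\<Sum>j<n. A $$ (i, j) * v $ j) * cnj (v $ i))"
    using assms by (auto simp: scalar_prod_def atLeast0LessThan intro!: sum.cong)
  then show ?thesis by (simp add: sum_distrib_right)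
qed

lemma cscalar_prod_self:
  fixes v :: "complex vec"
  assumes "v \<in> carrier_vec n"
  shows "v \<bullet>c v = complex_of_real (\<Sum>i<n. (cmod (v $ i))\<^sup>2)"
proof -
  have "v \<bullet>c v = (\<Sum>i<n. v $ i * cnj (v $ i))"
    using assms by (auto simp: scalar_prod_def atLeast0LessThan intro!: sum.cong)
  also have "\<dots> = (\<Sum>i<n. complex_of_real ((cmod (v $ i))\<^sup>2))"
    by (intro sum.cong refl complex_norm_square[symmetric])
  finally show ?thesis by simp
qed

section \<open>Unitary diagonalisation of Hermitian matrices\<close>

definition real_diag_mat :: "real list \<Rightarrow> complex mat" where
  "real_diag_mat es =
     Matrix.mat (length es) (length es) (\<lambda>(i, j). if i = j then complex_of_real (es ! i) else 0)"

lemma real_diag_mat_Cons: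
  "real_diag_mat (e # es) = four_block_mat (Matrix.mat 1 1 (\<lambda>_. complex_of_real e))
     (0\<^sub>m 1 (length es)) (0\<^sub>m (length es) 1) (real_diag_mat es)"
  by (intro eq_matI) (auto simp: real_diag_mat_def nth_Cons')

lemma length_eq_of_char_poly:
  fixes A :: "complex mat"
  assumes "A \<in> carrier_mat n n" "char_poly A = (\<Prod>a\<leftarrow>es. [:- a, 1:])"
  shows "length es = n"
  using degree_monic_char_poly[OF assms(1)] degree_linear_factors[of uminus es] assms(2) by simp

text \<open>\<open>gram_schmidt\<close> keeps the first vector but does not normalise. Rescaling
  every vector to length 1 turns \<open>v\<close> into a nonzero multiple of itself, hence the
  scalar \<open>c\<close>.\<close>

lemma orthonormal_completion:
  fixes v :: "complex vec"
  assumes v: "v \<in> carrier_vec n" and v0: "v \<noteq> 0\<^sub>v n"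
  obtains ws c where "set ws \<subseteq> carrier_vec n" "corthogonal ws" "length ws = n"
    "hd ws = c \<cdot>\<^sub>v v" "c \<noteq> 0" "\<And>w. w \<in> set ws \<Longrightarrow> w \<bullet>c w = 1"
proof -
  interpret cof_vec_space n "TYPE(complex)" .
  define b where "b = basis_completion v"
  define us where "us = gram_schmidt n b"
  note b = basis_completion[OF v v0, folded b_def]
  have n: "n \<noteq> 0" using v v0 by auto
  obtain vs where bv: "b = v # vs" using b n by (cases b) auto
  have us: "set us \<subseteq> carrier_vec n" "corthogonal us" "length us = n"
    using gram_schmidt_result[OF b(2) b(4) b(5) refl, folded us_def] b(6) by auto
  have hdus: "hd us = v" using gram_schmidt_hd[OF v, of vs, folded bv] unfolding us_def .
  define r where "r u = complex_of_real (1 / sqrt (Re (u \<bullet>c u)))" for u :: "complex vec"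
  \<comment> \<open>Nonnegativity in the order on complex numbers includes being real, which gives
    the second claim.\<close>
  have pos: "Re (u \<bullet>c u) > 0" "u \<bullet>c u = complex_of_real (Re (u \<bullet>c u))" if "u \<in> set us" for u
  proof -
    obtain i where i: "i < length us" "u = us ! i" using \<open>u \<in> set us\<close> by (auto simp: in_set_conv_nth)
    have "u \<bullet>c u \<noteq> 0" using corthogonalD[OF us(2) i(1) i(1)] i by simp
    moreover have "u \<bullet>c u \<ge> 0" by (rule conjugate_square_ge_0_vec)
    ultimately show "Re (u \<bullet>c u) > 0" "u \<bullet>c u = complex_of_real (Re (u \<bullet>c u))"
      by (auto simp: less_eq_complex_def complex_eq_iff less_le)
  qed
  define ws where "ws = map (\<lambda>u. r u \<cdot>\<^sub>v u) us"
  have prod: "(r u \<cdot>\<^sub>v u) \<bullet>c (r w \<cdot>\<^sub>v w) = r u * r w * (u \<bullet>c w)" if "u \<in> set us" "w \<in> set us" for u w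
  proof -
    have "u \<in> carrier_vec n" "w \<in> carrier_vec n" using that us by auto
    then show ?thesis by (simp add: conjugate_smult_vec r_def)
  qed
  have r0: "r u \<noteq> 0" if "u \<in> set us" for u using pos(1)[OF that] by (simp add: r_def)
  show thesis
  proof
    show "set ws \<subseteq> carrier_vec n" using us by (auto simp: ws_def)
    show "length ws = n" using us by (simp add: ws_def)
    show "corthogonal ws"
      by (rule corthogonalI) (use us r0 in \<open>auto simp: ws_def prod corthogonalD[OF us(2)]\<close>)
    have "us \<noteq> []" using us n by auto
    then show "hd ws = r v \<cdot>\<^sub>v v" using hdus by (simp add: ws_def hd_map)
    show "r v \<noteq> 0" using r0 hdus \<open>us \<noteq> []\<close> hd_in_set by metis
    fix w assume "w \<in> set ws"
    then obtain u where u: "u \<in> set us" "w = r u \<cdot>\<^sub>v u" by (auto simp: ws_def)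
    define q where "q = Re (u \<bullet>c u)"
    have q: "q > 0" "u \<bullet>c u = complex_of_real q" using pos[OF u(1)] by (simp_all add: q_def)
    have "r u = complex_of_real (1 / sqrt q)" by (simp only: r_def q_def)
    then have "w \<bullet>c w = complex_of_real (1 / sqrt q * (1 / sqrt q) * q)"
      unfolding u(2) prod[OF u(1) u(1)] q(2) of_real_mult by (simp only:)
    also have "1 / sqrt q * (1 / sqrt q) * q = 1" using q(1) by (simp add: field_simps)
    finally show "w \<bullet>c w = 1" by simp
  qed
qed

text \<open>Deflation along the list of roots: an eigenvector for the head becomes the first column
  of a unitary matrix, and conjugation splits off a 1 by 1 block. The order of the diagonal is the
  order of the given factorisation, so a sorted list yields a sorted diagonal.\<close>

theorem hermitian_spectral_decomposition:
  fixes A :: "complex mat"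
  assumes "A \<in> carrier_mat n n" "hermitian_mat A"
    and "char_poly A = (\<Prod>e\<leftarrow>es. [:- complex_of_real e, 1:])"
  shows "\<exists>U\<in>carrier_mat n n. mat_adjoint U * U = 1\<^sub>m n \<and> mat_adjoint U * A * U = real_diag_mat es"
  using assms
proof (induction es arbitrary: n A)
  case Nil
  then have "n = 0" using length_eq_of_char_poly[of A n "[]"] by simp
  then show ?case using Nil by (intro bexI[of _ "1\<^sub>m 0"]) (auto simp: real_diag_mat_def)
next
  case (Cons e es n A)
  note A = Cons.prems(1)
  define n1 where "n1 = length es"
  have n: "n = Suc n1"
    using length_eq_of_char_poly[of A n "map complex_of_real (e # es)"] Cons.prems
    by (simp add: o_def n1_def)
  define c where "c = complex_of_real e"
  have "eigenvalue A c"
    unfolding eigenvalue_root_char_poly[OF A] Cons.prems(3) c_def by simp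
  then obtain v where "eigenvector A v c" by (auto simp: eigenvalue_def)
  then have v: "v \<in> carrier_vec n" "v \<noteq> 0\<^sub>v n" "A *\<^sub>v v = c \<cdot>\<^sub>v v"
    using A by (auto simp: eigenvector_def)
  from orthonormal_completion[OF v(1,2)] obtain ws k where
    ws: "set ws \<subseteq> carrier_vec n" "corthogonal ws" "length ws = n"
    and k: "hd ws = k \<cdot>\<^sub>v v" "k \<noteq> 0" and one: "\<And>w. w \<in> set ws \<Longrightarrow> w \<bullet>c w = 1"
    by metis
  define W where "W = mat_of_cols n ws"
  have W: "W \<in> carrier_mat n n" using ws unfolding W_def by auto
  note W' = mat_adjoint_carrier[OF W]
  have "cols W = ws" using ws by (simp add: W_def)
  \<comment> \<open>\<open>corthogonal_inv\<close> divides each conjugated column by its squared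
    length, which is 1 here. This makes the library facts about orthogonal matrices available for
    the adjoint.\<close>
  then have W'_eq: "corthogonal_inv W = mat_adjoint W"
    using one W by (auto simp: corthogonal_inv_def mat_adjoint_def vec_inv_def
        intro!: arg_cong[of _ _ "mat_of_rows n"])
  have W'W: "mat_adjoint W * W = 1\<^sub>m n"
    using corthogonal_inv_result[OF orthogonal_mat_of_cols[OF ws], folded W_def] W W'
    unfolding W'_eq inverts_mat_def by simp
  have WW': "W * mat_adjoint W = 1\<^sub>m n" by (rule mat_mult_left_right_inverse[OF W' W W'W])
  define A' where "A' = mat_adjoint W * A * W"
  have A': "A' \<in> carrier_mat n n"
    unfolding A'_def by (rule mult_carrier_mat[OF mult_carrier_mat[OF W' A] W])
  have "similar_mat_wit A' A (mat_adjoint W) W"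
    by (rule similar_mat_witI[of _ _ n]) (use W W' A A' W'W WW' in \<open>auto simp: A'_def\<close>)
  then have cpA': "char_poly A' = char_poly A"
    by (intro char_poly_similar) (auto simp: similar_mat_def)
  have hA: "mat_adjoint A = A" using Cons.prems(2) by (simp add: hermitian_mat_def)
  have "mat_adjoint A' = A'"
    using W W' A by (simp add: A'_def mat_adjoint_mult[of _ n n _ n] hA assoc_mult_mat[of _ n n _ n _ n])
  then have hA': "hermitian_mat A'" using A' by (auto simp: hermitian_mat_def)
  have col0: "col A' 0 = vec n (\<lambda>i. if i = 0 then c else 0)"
    unfolding A'_def W'_eq[symmetric] unfolding W_def
  proof (rule corthogonal_col_ev_0[OF A _ _ _ _ k(1) ws])
    show "A *\<^sub>v (k \<cdot>\<^sub>v v) = c \<cdot>\<^sub>v (k \<cdot>\<^sub>v v)"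
      using v A by (simp add: mult_mat_vec[OF A] smult_smult_assoc mult.commute)
    show "k \<cdot>\<^sub>v v \<noteq> 0\<^sub>v n"
    proof
      assume "k \<cdot>\<^sub>v v = 0\<^sub>v n"
      then have "(1 / k) \<cdot>\<^sub>v (k \<cdot>\<^sub>v v) = 0\<^sub>v n" by (auto intro!: eq_vecI)
      then show False using v(1,2) k(2) by (simp add: smult_smult_assoc)
    qed
  qed (use v k n in auto)
  have A'0: "A' $$ (i, 0) = (if i = 0 then c else 0)" if "i < n" for i
    using arg_cong[OF col0, of "\<lambda>u. u $ i"] A' that n by simp
  \<comment> \<open>The zeros of the first column pass to the first row by symmetry; the corner
    entry is consistent because \<open>c\<close> is real.\<close>
  have A'0': "A' $$ (0, i) = (if i = 0 then c else 0)" if "i < n" for i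
    using hermitian_matD[OF hA' A', of 0 i] A'0[OF that] that n by (auto simp: c_def)
  define A3 where "A3 = Matrix.mat n1 n1 (\<lambda>(i, j). A' $$ (Suc i, Suc j))"
  define A1 where "A1 = Matrix.mat 1 1 (\<lambda>_::nat \<times> nat. c)"
  have A3: "A3 \<in> carrier_mat n1 n1" and A1: "A1 \<in> carrier_mat 1 1" by (simp_all add: A3_def A1_def)
  have block: "A' = four_block_mat A1 (0\<^sub>m 1 n1) (0\<^sub>m n1 1) A3"
    using A' n by (intro eq_matI) (auto simp: A1_def A3_def A'0 A'0')
  have hA3: "hermitian_mat A3"
  proof (rule hermitian_matI[OF A3])
    fix i j assume ij: "i < n1" "j < n1"
    then have "A' $$ (Suc i, Suc j) = cnj (A' $$ (Suc j, Suc i))"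
      using n by (intro hermitian_matD[OF hA' A']) simp_all
    then show "A3 $$ (i, j) = cnj (A3 $$ (j, i))" using ij by (simp only: A3_def index_mat prod.case)
  qed
  have "char_poly A' = char_poly A1 * char_poly A3"
    unfolding block by (rule char_poly_four_block_zeros_col[OF A1 _ A3]) simp
  moreover have "char_poly A1 = [:- c, 1:]"
    by (simp add: A1_def char_poly_defs Determinant.det_def sign_def)
  ultimately have "[:- c, 1:] * char_poly A3 = [:- c, 1:] * (\<Prod>e\<leftarrow>es. [:- complex_of_real e, 1:])"
    using cpA' Cons.prems(3) by (simp add: c_def)
  \<comment> \<open>Polynomials over the complex numbers have no zero divisors, so the common linear
    factor cancels.\<close>
  then have "char_poly A3 = (\<Prod>e\<leftarrow>es. [:- complex_of_real e, 1:])"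
    by (metis mult_cancel_left pCons_eq_0_iff zero_neq_one)
  from Cons.IH[OF A3 hA3 this] obtain U3 where U3: "U3 \<in> carrier_mat n1 n1"
    "mat_adjoint U3 * U3 = 1\<^sub>m n1" "mat_adjoint U3 * A3 * U3 = real_diag_mat es" by auto
  note U3' = mat_adjoint_carrier[OF U3(1)]
  define P where "P = four_block_mat (1\<^sub>m 1) (0\<^sub>m 1 n1) (0\<^sub>m n1 1) U3"
  have P: "P \<in> carrier_mat n n" using U3 n by (auto simp: P_def)
  note P' = mat_adjoint_carrier[OF P]
  have z: "mat_adjoint (0\<^sub>m a b) = (0\<^sub>m b a :: complex mat)" for a b
    by (intro eq_matI) auto
  have P'_eq: "mat_adjoint P = four_block_mat (1\<^sub>m 1) (0\<^sub>m 1 n1) (0\<^sub>m n1 1) (mat_adjoint U3)"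
    unfolding P_def using U3 by (subst mat_adjoint_four_block[of _ 1 1 _ n1 _ n1]) (auto simp: z)
  have mult_block: "four_block_mat B (0\<^sub>m 1 n1) (0\<^sub>m n1 1) C * four_block_mat B' (0\<^sub>m 1 n1) (0\<^sub>m n1 1) C' =
      four_block_mat (B * B') (0\<^sub>m 1 n1) (0\<^sub>m n1 1) (C * C')"
    if "B \<in> carrier_mat 1 1" "B' \<in> carrier_mat 1 1" "C \<in> carrier_mat n1 n1" "C' \<in> carrier_mat n1 n1"
    for B B' C C' :: "complex mat"
    using that by (subst mult_four_block_mat[of _ 1 1 _ n1 _ n1 _ _ 1 _ n1]) auto
  have one: "1\<^sub>m 1 \<in> carrier_mat 1 (1::nat)" by simp
  have P'P: "mat_adjoint P * P = 1\<^sub>m n"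
    unfolding P'_eq unfolding P_def n mult_block[OF one one U3' U3(1)]
    using four_block_one_mat[of 1 n1] by (simp add: U3(2))
  have P'AP: "mat_adjoint P * A' * P = real_diag_mat (e # es)"
    unfolding P'_eq unfolding P_def block mult_block[OF one A1 U3' A3]
      mult_block[OF mult_carrier_mat[OF one A1] one mult_carrier_mat[OF U3' A3] U3(1)]
    using A1 by (simp add: U3(3) real_diag_mat_Cons n1_def A1_def c_def)
  have UU: "mat_adjoint (W * P) = mat_adjoint P * mat_adjoint W" by (rule mat_adjoint_mult[OF W P])
  have cl: "Y * Z \<in> carrier_mat n n" if "Y \<in> carrier_mat n n" "Z \<in> carrier_mat n n" for Y Z :: "complex mat"
    using that by (rule mult_carrier_mat)
  show ?case
  proof (intro bexI conjI)
    \<comment> \<open>The change of basis by \<open>W\<close> is followed by the diagonalisation of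
      the remaining block, extended by 1 in the corner.\<close>
    show "W * P \<in> carrier_mat n n" using W P by simp
    have "mat_adjoint (W * P) * (W * P) = mat_adjoint P * (mat_adjoint W * W) * P"
      unfolding UU using W W' P P' by (simp add: cl assoc_mult_mat[of _ n n _ n _ n])
    then show "mat_adjoint (W * P) * (W * P) = 1\<^sub>m n" by (simp add: W'W P'P right_mult_one_mat[OF P'])
    have "mat_adjoint (W * P) * A * (W * P) = mat_adjoint P * A' * P"
      unfolding UU A'_def using W W' P P' A by (simp add: cl assoc_mult_mat[of _ n n _ n _ n])
    then show "mat_adjoint (W * P) * A * (W * P) = real_diag_mat (e # es)" by (simp add: P'AP)
  qed
qed

text \<open>For an eigenvector the form equals \<open>a\<close> times the squared length, and the
  form of a Hermitian matrix is its own conjugate, as exchanging the two summation indices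
  shows.\<close>

lemma eigenvalues_hermitian_real:
  fixes A :: "complex mat"
  assumes A: "A \<in> carrier_mat n n" and h: "hermitian_mat A" and a: "poly (char_poly A) a = 0"
  shows "complex_of_real (Re a) = a"
proof -
  have "eigenvalue A a" using a eigenvalue_root_char_poly[OF A] by simp
  then obtain v where v: "v \<in> carrier_vec n" "v \<noteq> 0\<^sub>v n" "A *\<^sub>v v = a \<cdot>\<^sub>v v"
    using A by (auto simp: eigenvalue_def eigenvector_def)
  have "(A *\<^sub>v v) \<bullet>c v = a * (v \<bullet>c v)" using v by simp
  moreover have "cnj ((A *\<^sub>v v) \<bullet>c v) = (A *\<^sub>v v) \<bullet>c v"
  proof -
    have "cnj ((A *\<^sub>v v) \<bullet>c v) = (\<Sum>i<n. \<Sum>j<n. A $$ (j, i) * v $ i * cnj (v $ j))"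
      unfolding quadratic_form_sum[OF A v(1)] cnj_sum
    proof (intro sum.cong refl)
      fix i j assume "i \<in> {..<n}" "j \<in> {..<n}"
      then have "cnj (A $$ (i, j)) = A $$ (j, i)" by (metis hermitian_matD[OF h A] lessThan_iff)
      then show "cnj (A $$ (i, j) * v $ j * cnj (v $ i)) = A $$ (j, i) * v $ i * cnj (v $ j)"
        by (simp only: complex_cnj_mult complex_cnj_cnj mult_ac)
    qed
    also have "\<dots> = (A *\<^sub>v v) \<bullet>c v"
      unfolding quadratic_form_sum[OF A v(1)] by (rule sum.swap)
    finally show ?thesis .
  qed
  moreover have "v \<bullet>c v \<noteq> 0" using v by simp
  moreover have "cnj (v \<bullet>c v) = v \<bullet>c v"
    unfolding cscalar_prod_self[OF v(1)] by (simp only: complex_cnj_complex_of_real)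
  ultimately have "cnj a = a" by (metis complex_cnj_mult mult_cancel_right)
  then show ?thesis by (simp add: complex_eq_iff)
qed

text \<open>The characteristic polynomial splits over the complex numbers and all its roots are
  real, so the \<open>Re\<close> in \<open>ordered_eigenvalues\<close> loses nothing and sorting
  only permutes the linear factors.\<close>

lemma ordered_eigenvalues_hermitian:
  fixes A :: "complex mat"
  assumes A: "A \<in> carrier_mat n n" and h: "hermitian_mat A"
  shows "char_poly A = (\<Prod>e\<leftarrow>ordered_eigenvalues A. [:- complex_of_real e, 1:])"
    and "length (ordered_eigenvalues A) = n"
    and "sorted (rev (ordered_eigenvalues A))"
proof -
  obtain as where as: "char_poly A = (\<Prod>a\<leftarrow>as. [:- a, 1:])" "length as = n"
    using char_poly_factorized[OF A] by auto
  have pr: "proots (char_poly A) = mset as"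
    unfolding as(1) 
  proof (induction as)
    case (Cons a as)
    have "[:- a, 1:] \<noteq> 0" "(\<Prod>a\<leftarrow>as. [:- a, 1:]) \<noteq> 0" by (auto simp: prod_list_zero_iff)
    from proots_mult[OF this] show ?case
      by (simp only: Cons.IH list.map prod_list.Cons proots_linear_factor mset.simps) simp
  qed simp
  have real: "complex_of_real (Re a) = a" if "a \<in> set as" for a
  proof (rule eigenvalues_hermitian_real[OF A h])
    show "poly (char_poly A) a = 0" using that unfolding as(1) by (auto simp: poly_prod_list prod_list_zero_iff)
  qed
  have ms: "mset (ordered_eigenvalues A) = image_mset Re (mset as)"
    by (simp add: ordered_eigenvalues_def pr)
  have "(\<Prod>e\<leftarrow>ordered_eigenvalues A. [:- complex_of_real e, 1:]) =
      prod_mset (image_mset (\<lambda>e. [:- complex_of_real e, 1:]) (mset (ordered_eigenvalues A)))"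
    by (simp add: prod_mset_prod_list[symmetric])
  also have "\<dots> = prod_mset (image_mset (\<lambda>a. [:- a, 1:]) (mset as))"
    unfolding ms multiset.map_comp o_def
    by (intro arg_cong[of _ _ prod_mset] image_mset_cong) (use real in auto)
  also have "\<dots> = (\<Prod>a\<leftarrow>as. [:- a, 1:])" by (simp add: prod_mset_prod_list[symmetric])
  finally show "char_poly A = (\<Prod>e\<leftarrow>ordered_eigenvalues A. [:- complex_of_real e, 1:])"
    by (simp add: as(1))
  have "size (mset (ordered_eigenvalues A)) = n" unfolding ms by (simp add: as(2))
  then show "length (ordered_eigenvalues A) = n" by simp
  show "sorted (rev (ordered_eigenvalues A))" by (simp add: ordered_eigenvalues_def)
qed

text \<open>The entries of \<open>mat_adjoint U *\<^sub>v v\<close> are the coordinates of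
  \<open>v\<close> in an orthonormal eigenbasis. The eigenvalue arguments below use the spectral
  theorem in this form.\<close>

lemma hermitian_diagonalization:
  fixes A :: "complex mat"
  assumes A: "A \<in> carrier_mat n n" and h: "hermitian_mat A"
  obtains U where "U \<in> carrier_mat n n" "mat_adjoint U * U = 1\<^sub>m n"
    "\<And>v. v \<in> carrier_vec n \<Longrightarrow>
       Re ((A *\<^sub>v v) \<bullet>c v) = (\<Sum>i<n. ordered_eigenvalues A ! i * (cmod ((mat_adjoint U *\<^sub>v v) $ i))\<^sup>2)"
    "\<And>v. v \<in> carrier_vec n \<Longrightarrow> Re (v \<bullet>c v) = (\<Sum>i<n. (cmod ((mat_adjoint U *\<^sub>v v) $ i))\<^sup>2)"
proof -
  let ?es = "ordered_eigenvalues A"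
  note oe = ordered_eigenvalues_hermitian[OF A h]
  from hermitian_spectral_decomposition[OF A h oe(1)] obtain U where
    U: "U \<in> carrier_mat n n" "mat_adjoint U * U = 1\<^sub>m n" "mat_adjoint U * A * U = real_diag_mat ?es" by auto
  note U' = mat_adjoint_carrier[OF U(1)]
  have UU': "U * mat_adjoint U = 1\<^sub>m n" by (rule mat_mult_left_right_inverse[OF U' U(1) U(2)])
  have adj: "(B *\<^sub>v x) \<bullet>c y = x \<bullet>c (mat_adjoint B *\<^sub>v y)"
    if "B \<in> carrier_mat n n" "x \<in> carrier_vec n" "y \<in> carrier_vec n" for B :: "complex mat" and x y
  proof -
    have "(B *\<^sub>v x) \<bullet>c y = (\<Sum>i<n. \<Sum>j<n. B $$ (i, j) * x $ j * cnj (y $ i))"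
      using that by (auto simp: scalar_prod_def atLeast0LessThan sum_distrib_right intro!: sum.cong)
    also have "\<dots> = (\<Sum>j<n. \<Sum>i<n. B $$ (i, j) * x $ j * cnj (y $ i))" by (rule sum.swap)
    also have "\<dots> = x \<bullet>c (mat_adjoint B *\<^sub>v y)"
      using that by (auto simp: scalar_prod_def atLeast0LessThan sum_distrib_left mult_ac intro!: sum.cong)
    finally show ?thesis .
  qed
  show thesis
  proof
    fix v :: "complex vec" assume v: "v \<in> carrier_vec n"
    define c where "c = mat_adjoint U *\<^sub>v v"
    have c: "c \<in> carrier_vec n" using U' v by (simp add: c_def)
    have vc: "v = U *\<^sub>v c"
      unfolding c_def assoc_mult_mat_vec[OF U(1) U' v, symmetric] UU' using v by simp
    have "v \<bullet>c v = c \<bullet>c c" using adj[OF U(1) c v] unfolding vc[symmetric] c_def[symmetric] .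
    then show "Re (v \<bullet>c v) = (\<Sum>i<n. (cmod ((mat_adjoint U *\<^sub>v v) $ i))\<^sup>2)"
      unfolding cscalar_prod_self[OF c] c_def[symmetric] by (simp only: Re_complex_of_real)
    have AU: "A * U \<in> carrier_mat n n" using A U by simp
    have "(A *\<^sub>v v) \<bullet>c v = (mat_adjoint U *\<^sub>v (A *\<^sub>v v)) \<bullet>c c"
      using adj[OF U' _ c, of "A *\<^sub>v v"] A v unfolding mat_adjoint_adjoint vc[symmetric] by simp
    also have "mat_adjoint U *\<^sub>v (A *\<^sub>v v) = real_diag_mat ?es *\<^sub>v c"
      unfolding vc U(3)[symmetric] assoc_mult_mat_vec[OF A U(1) c, symmetric]
        assoc_mult_mat_vec[OF U' AU c, symmetric] assoc_mult_mat[OF U' A U(1)] ..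
    also have "real_diag_mat ?es *\<^sub>v c = vec n (\<lambda>i. complex_of_real (?es ! i) * c $ i)"
      using oe(2) c by (intro eq_vecI)
        (auto simp: real_diag_mat_def scalar_prod_def mult_delta_left)
    also have "\<dots> \<bullet>c c = (\<Sum>i<n. complex_of_real (?es ! i * (cmod (c $ i))\<^sup>2))"
      using c unfolding of_real_mult complex_norm_square
      by (simp add: scalar_prod_def atLeast0LessThan mult.assoc)
    finally show "Re ((A *\<^sub>v v) \<bullet>c v) = (\<Sum>i<n. ?es ! i * (cmod ((mat_adjoint U *\<^sub>v v) $ i))\<^sup>2)"
      unfolding c_def[symmetric] by (simp only: Re_sum Re_complex_of_real)
  qed (use U in auto)
qed

section \<open>Comparing eigenvalues through quadratic forms\<close>

lemma ordered_eigenvalues_antimono: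
  fixes A :: "complex mat"
  assumes A: "A \<in> carrier_mat n n" and h: "hermitian_mat A" and "i \<le> j" "j < n"
  shows "ordered_eigenvalues A ! j \<le> ordered_eigenvalues A ! i"
  using ordered_eigenvalues_hermitian(2,3)[OF A h] assms(3,4) by (intro sorted_rev_nth_mono) auto

text \<open>The two orthogonality conditions \<open>v \<bottom> a\<^sub>i\<close> (\<open>i > j\<close>) and \<open>v \<bottom> b\<^sub>i\<close> (\<open>i < j\<close>) on the eigenvectors
  of \<open>A\<close> and \<open>B\<close> are \<open>n - 1\<close> linear equations; stacking them with a zero row in place \<open>j\<close> gives a
  singular square matrix, which yields a test vector without any dimension count.\<close>

lemma eigenvalue_le_of_quadratic_form_le:
  fixes A B :: "complex mat"
  assumes A: "A \<in> carrier_mat n n" "hermitian_mat A" and B: "B \<in> carrier_mat n n" "hermitian_mat B"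
    and le: "\<And>v. v \<in> carrier_vec n \<Longrightarrow>
      Re ((A *\<^sub>v v) \<bullet>c v) \<le> Re ((B *\<^sub>v v) \<bullet>c v) + c * Re (v \<bullet>c v)"
    and j: "j < n"
  shows "ordered_eigenvalues A ! j \<le> ordered_eigenvalues B ! j + c"
proof -
  let ?a = "ordered_eigenvalues A" and ?b = "ordered_eigenvalues B"
  obtain U where U: "U \<in> carrier_mat n n" "mat_adjoint U * U = 1\<^sub>m n" and
    UA: "\<And>v. v \<in> carrier_vec n \<Longrightarrow>
       Re ((A *\<^sub>v v) \<bullet>c v) = (\<Sum>i<n. ?a ! i * (cmod ((mat_adjoint U *\<^sub>v v) $ i))\<^sup>2)" and
    UI: "\<And>v. v \<in> carrier_vec n \<Longrightarrow> Re (v \<bullet>c v) = (\<Sum>i<n. (cmod ((mat_adjoint U *\<^sub>v v) $ i))\<^sup>2)"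
    by (rule hermitian_diagonalization[OF A]) (rule that)
  obtain W where W: "W \<in> carrier_mat n n" "mat_adjoint W * W = 1\<^sub>m n" and
    WB: "\<And>v. v \<in> carrier_vec n \<Longrightarrow>
       Re ((B *\<^sub>v v) \<bullet>c v) = (\<Sum>i<n. ?b ! i * (cmod ((mat_adjoint W *\<^sub>v v) $ i))\<^sup>2)" and
    WI: "\<And>v. v \<in> carrier_vec n \<Longrightarrow> Re (v \<bullet>c v) = (\<Sum>i<n. (cmod ((mat_adjoint W *\<^sub>v v) $ i))\<^sup>2)"
    by (rule hermitian_diagonalization[OF B]) (rule that)
  define S where "S = Matrix.mat n n (\<lambda>(i, k).
    if i < j then mat_adjoint W $$ (i, k) else if j < i then mat_adjoint U $$ (i, k) else 0)"
  have S: "S \<in> carrier_mat n n" by (simp add: S_def)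
  have "row S j = 0\<^sub>v n" using j by (intro eq_vecI) (auto simp: S_def)
  then have "Determinant.det S = 0"
    using laplace_expansion_row[OF S j] j S by (auto simp: S_def intro!: sum.neutral)
  then obtain v where v: "v \<in> carrier_vec n" "v \<noteq> 0\<^sub>v n" "S *\<^sub>v v = 0\<^sub>v n"
    using det_0_iff_vec_prod_zero[OF S] by auto
  have Wv: "(mat_adjoint W *\<^sub>v v) $ i = 0" if "i < j" for i
  proof -
    have "(S *\<^sub>v v) $ i = (mat_adjoint W *\<^sub>v v) $ i"
      using that j S W(1) v(1) by (auto simp: scalar_prod_def S_def intro!: sum.cong)
    then show ?thesis using v(3) that j by simp
  qed
  have Uv: "(mat_adjoint U *\<^sub>v v) $ i = 0" if "j < i" "i < n" for i
  proof -
    have "(S *\<^sub>v v) $ i = (mat_adjoint U *\<^sub>v v) $ i"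
      using that j S U(1) v(1) by (auto simp: scalar_prod_def S_def intro!: sum.cong)
    then show ?thesis using v(3) that j by simp
  qed
  \<comment> \<open>In the eigenbasis of \<open>A\<close> the vector has coordinates only at
    \<open>i \<le> j\<close>, where the eigenvalues are at least the one at \<open>j\<close>. In
    that of \<open>B\<close> it has them only at \<open>i \<ge> j\<close>, where they are at most
    the one at \<open>j\<close>.\<close>
  have "?a ! j * Re (v \<bullet>c v) \<le> Re ((A *\<^sub>v v) \<bullet>c v)"
    unfolding UA[OF v(1)] UI[OF v(1)] sum_distrib_left
  proof (rule sum_mono)
    fix i assume "i \<in> {..<n}"
    then show "?a ! j * (cmod ((mat_adjoint U *\<^sub>v v) $ i))\<^sup>2 \<le> ?a ! i * (cmod ((mat_adjoint U *\<^sub>v v) $ i))\<^sup>2"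
      using Uv[of i] ordered_eigenvalues_antimono[OF A, of i j] j
      by (cases "j < i") (auto intro: mult_right_mono)
  qed
  also note le[OF v(1)]
  also have "Re ((B *\<^sub>v v) \<bullet>c v) \<le> ?b ! j * Re (v \<bullet>c v)"
    unfolding WB[OF v(1)] WI[OF v(1)] sum_distrib_left
  proof (rule sum_mono)
    fix i assume "i \<in> {..<n}"
    then show "?b ! i * (cmod ((mat_adjoint W *\<^sub>v v) $ i))\<^sup>2 \<le> ?b ! j * (cmod ((mat_adjoint W *\<^sub>v v) $ i))\<^sup>2"
      using Wv[of i] ordered_eigenvalues_antimono[OF B, of j i] j
      by (cases "i < j") (auto intro: mult_right_mono)
  qed
  finally have "?a ! j * Re (v \<bullet>c v) \<le> (?b ! j + c) * Re (v \<bullet>c v)" by (simp add: algebra_simps)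
  moreover have "0 < Re (v \<bullet>c v)"
    using conjugate_square_greater_0_vec[OF v(1)] v(2) by (simp add: less_complex_def)
  ultimately show ?thesis by simp
qed

text \<open>In the eigenbasis the form is a weighted sum of eigenvalues, of which the last is the
  smallest. This is how \<sigma>_M enters the relative estimate.\<close>

lemma least_eigenvalue_le_quadratic_form:
  fixes A :: "complex mat"
  assumes A: "A \<in> carrier_mat n n" "hermitian_mat A" and n: "n \<ge> 1" and v: "v \<in> carrier_vec n"
  shows "ordered_eigenvalues A ! (n - 1) * Re (v \<bullet>c v) \<le> Re ((A *\<^sub>v v) \<bullet>c v)"
proof -
  obtain U where "U \<in> carrier_mat n n" "mat_adjoint U * U = 1\<^sub>m n" and
    UA: "\<And>v. v \<in> carrier_vec n \<Longrightarrow>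
       Re ((A *\<^sub>v v) \<bullet>c v) = (\<Sum>i<n. ordered_eigenvalues A ! i * (cmod ((mat_adjoint U *\<^sub>v v) $ i))\<^sup>2)" and
    UI: "\<And>v. v \<in> carrier_vec n \<Longrightarrow> Re (v \<bullet>c v) = (\<Sum>i<n. (cmod ((mat_adjoint U *\<^sub>v v) $ i))\<^sup>2)"
    by (rule hermitian_diagonalization[OF A]) (rule that)
  show ?thesis
    unfolding UA[OF v] UI[OF v] using n by (auto simp: sum_distrib_left intro!: sum_mono mult_right_mono ordered_eigenvalues_antimono[OF A])
qed

text \<open>Column \<open>j\<close> of \<open>U\<close> has a unit vector as its coordinates, so the
  form takes the value of the eigenvalue at \<open>j\<close> there.\<close>

lemma ordered_eigenvalues_nonneg:
  assumes A: "A \<in> carrier_mat n n" "pos_semidef A" and j: "j < n"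
  shows "0 \<le> ordered_eigenvalues A ! j"
proof -
  have h: "hermitian_mat A" using A(2) by (simp add: pos_semidef_def)
  obtain U where U: "U \<in> carrier_mat n n" "mat_adjoint U * U = 1\<^sub>m n" and
    UA: "\<And>v. v \<in> carrier_vec n \<Longrightarrow>
       Re ((A *\<^sub>v v) \<bullet>c v) = (\<Sum>i<n. ordered_eigenvalues A ! i * (cmod ((mat_adjoint U *\<^sub>v v) $ i))\<^sup>2)" and
    "\<And>v. v \<in> carrier_vec n \<Longrightarrow> Re (v \<bullet>c v) = (\<Sum>i<n. (cmod ((mat_adjoint U *\<^sub>v v) $ i))\<^sup>2)"
    by (rule hermitian_diagonalization[OF A(1) h]) (rule that)
  have c: "col U j \<in> carrier_vec n" using U(1) by (metis col_dim carrier_matD(1))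
  have "mat_adjoint U *\<^sub>v col U j = unit_vec n j"
    using col_mult2[OF mat_adjoint_carrier[OF U(1)] U(1) j] j by (simp add: U(2))
  then have "Re ((A *\<^sub>v col U j) \<bullet>c col U j) =
      (\<Sum>i<n. ordered_eigenvalues A ! i * (cmod (unit_vec n j $ i))\<^sup>2)"
    by (simp only: UA[OF c])
  also have "\<dots> = (\<Sum>i<n. if i = j then ordered_eigenvalues A ! i else 0)"
    using j by (intro sum.cong) auto
  finally have "Re ((A *\<^sub>v col U j) \<bullet>c col U j) = ordered_eigenvalues A ! j" using j by simp
  then show ?thesis using A c by (auto simp: pos_semidef_def)
qed

section \<open>Jordan decomposition\<close>

lemma signed_borel_measure_empty: "signed_borel_measure \<nu> \<Longrightarrow> \<nu> {} = 0"
  by (simp add: signed_borel_measure_def)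

lemma signed_borel_measure_Un:
  assumes \<nu>: "signed_borel_measure \<nu>" and A: "A \<in> sets borel" "B \<in> sets borel" "A \<inter> B = {}"
  shows "\<nu> (A \<union> B) = \<nu> A + \<nu> B"
proof -
  have "range (binaryset A B) \<subseteq> sets borel" using A by (auto simp: range_binaryset_eq)
  moreover have "disjoint_family (binaryset A B)"
    using A(3) by (auto simp: disjoint_family_on_def binaryset_def)
  ultimately have "(\<lambda>i. \<nu> (binaryset A B i)) sums \<nu> (\<Union>i. binaryset A B i)"
    using \<nu> by (auto simp: signed_borel_measure_def)
  moreover have "(\<lambda>i. \<nu> (binaryset A B i)) sums (\<nu> A + \<nu> B)"
    by (rule binaryset_sums) (rule signed_borel_measure_empty[OF \<nu>])
  ultimately show ?thesis by (simp add: UN_binaryset_eq sums_unique2)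
qed

lemma signed_borel_measure_uminus:
  assumes "signed_borel_measure \<nu>"
  shows "signed_borel_measure (\<lambda>A. - \<nu> A)"
  using assms by (auto simp: signed_borel_measure_def intro: sums_minus)

text \<open>Truncating negative numbers to 0 is only subadditive, hence no equality.\<close>

lemma ennreal_sum_le: "ennreal (sum f I) \<le> (\<Sum>i\<in>I. ennreal (f i))"
proof (induction I rule: infinite_finite_induct)
  case (insert i I)
  have "ennreal (f i + sum f I) \<le> ennreal (max 0 (f i) + max 0 (sum f I))"
    by (intro ennreal_leI) auto
  also have "\<dots> = ennreal (f i) + ennreal (sum f I)"
    by (subst ennreal_plus) (auto simp: ennreal_max_0)
  also have "\<dots> \<le> ennreal (f i) + (\<Sum>i\<in>I. ennreal (f i))" using insert.IH by (rule add_left_mono)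
  finally show ?case using insert.hyps by simp
qed auto

text \<open>The set function inside \<open>positive_part\<close>, named separately because its
  countable additivity must be known before the measure built from it can be evaluated.\<close>

definition upper_variation :: "('w::topological_space set \<Rightarrow> real) \<Rightarrow> 'w set \<Rightarrow> ennreal" where
  "upper_variation \<nu> A = (SUP B\<in>{B\<in>sets borel. B \<subseteq> A}. ennreal (\<nu> B))"

lemma upper_variation_upper: "B \<in> sets borel \<Longrightarrow> B \<subseteq> A \<Longrightarrow> ennreal (\<nu> B) \<le> upper_variation \<nu> A"
  unfolding upper_variation_def by (rule SUP_upper) simp

lemma upper_variation_mono: "A \<subseteq> B \<Longrightarrow> upper_variation \<nu> A \<le> upper_variation \<nu> B"
  unfolding upper_variation_def by (rule SUP_subset_mono) auto

lemma upper_variation_empty: "signed_borel_measure \<nu> \<Longrightarrow> upper_variation \<nu> {} = 0"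
  by (intro antisym) (auto simp: upper_variation_def signed_borel_measure_empty intro!: SUP_least)

lemma SUP_add_SUP_le:
  fixes f g :: "'a \<Rightarrow> ennreal"
  assumes "I \<noteq> {}" "J \<noteq> {}" "\<And>i j. i \<in> I \<Longrightarrow> j \<in> J \<Longrightarrow> f i + g j \<le> c"
  shows "(SUP i\<in>I. f i) + (SUP j\<in>J. g j) \<le> c"
proof -
  have "(SUP i\<in>I. f i) + (SUP j\<in>J. g j) = (SUP j\<in>J. (SUP i\<in>I. f i) + g j)"
    by (rule ennreal_SUP_add_right) fact
  also have "\<dots> \<le> c"
  proof (rule SUP_least)
    fix j assume j: "j \<in> J"
    have "(SUP i\<in>I. f i) + g j = (SUP i\<in>I. f i + g j)"
      by (rule ennreal_SUP_add_left[symmetric]) fact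
    also have "\<dots> \<le> c" using assms(3) j by (intro SUP_least)
    finally show "(SUP i\<in>I. f i) + g j \<le> c" .
  qed
  finally show ?thesis .
qed

text \<open>Competitors inside \<open>A\<close> and inside \<open>B\<close> are disjoint, so their
  union competes on the right. If one of them has nonpositive value, it is truncated to 0 and the
  other competes alone.\<close>

lemma upper_variation_superadditive:
  assumes \<nu>: "signed_borel_measure \<nu>" and AB: "A \<inter> B = {}"
  shows "upper_variation \<nu> A + upper_variation \<nu> B \<le> upper_variation \<nu> (A \<union> B)"
  unfolding upper_variation_def[of \<nu> A] upper_variation_def[of \<nu> B]
proof (rule SUP_add_SUP_le)
  fix C D assume "C \<in> {C \<in> sets borel. C \<subseteq> A}" "D \<in> {D \<in> sets borel. D \<subseteq> B}"
  then have CD: "C \<in> sets borel" "C \<subseteq> A" "D \<in> sets borel" "D \<subseteq> B" by auto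
  then have "C \<inter> D = {}" using AB by auto
  consider "\<nu> C \<le> 0" | "\<nu> D \<le> 0" | "0 \<le> \<nu> C" "0 \<le> \<nu> D" by linarith
  then show "ennreal (\<nu> C) + ennreal (\<nu> D) \<le> upper_variation \<nu> (A \<union> B)"
  proof cases
    case 1
    then show ?thesis using upper_variation_upper[of D "A \<union> B" \<nu>] CD by (auto simp: ennreal_neg)
  next
    case 2
    then show ?thesis using upper_variation_upper[of C "A \<union> B" \<nu>] CD by (auto simp: ennreal_neg)
  next
    case 3
    then have "ennreal (\<nu> C) + ennreal (\<nu> D) = ennreal (\<nu> (C \<union> D))"
      using signed_borel_measure_Un[OF \<nu> CD(1,3) \<open>C \<inter> D = {}\<close>] by (simp add: ennreal_plus)
    then show ?thesis using upper_variation_upper[of "C \<union> D" "A \<union> B" \<nu>] CD by auto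
  qed
qed auto

text \<open>One direction iterates superadditivity over finite unions and passes to the limit. For
  the other, a competitor inside the union is cut along the sets \<open>A i\<close>, and countable
  additivity of \<nu> is applied to the pieces.\<close>

lemma upper_variation_suminf:
  assumes \<nu>: "signed_borel_measure \<nu>"
    and A: "range A \<subseteq> sets borel" "disjoint_family (A :: nat \<Rightarrow> _)"
  shows "(\<Sum>i. upper_variation \<nu> (A i)) = upper_variation \<nu> (\<Union>i. A i)"
proof (rule antisym)
  have "(\<Sum>i<n. upper_variation \<nu> (A i)) \<le> upper_variation \<nu> (\<Union>i<n. A i)" for n
  proof (induction n)
    case (Suc n)
    have "A i \<inter> A n = {}" if "i < n" for i
      using disjoint_family_onD[OF A(2), of i n] that by simp
    then have "(\<Union>i<n. A i) \<inter> A n = {}" by auto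
    have "(\<Sum>i<Suc n. upper_variation \<nu> (A i)) \<le> upper_variation \<nu> (\<Union>i<n. A i) + upper_variation \<nu> (A n)"
      using Suc by (simp add: add_right_mono)
    also have "\<dots> \<le> upper_variation \<nu> ((\<Union>i<n. A i) \<union> A n)"
      by (rule upper_variation_superadditive[OF \<nu>]) fact
    finally show ?case by (simp add: lessThan_Suc Un_commute)
  qed simp
  also have "upper_variation \<nu> (\<Union>i<n. A i) \<le> upper_variation \<nu> (\<Union>i. A i)" for n
    by (rule upper_variation_mono) auto
  finally show "(\<Sum>i. upper_variation \<nu> (A i)) \<le> upper_variation \<nu> (\<Union>i. A i)"
    by (intro suminf_le_const) auto
next
  show "upper_variation \<nu> (\<Union>i. A i) \<le> (\<Sum>i. upper_variation \<nu> (A i))"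
    unfolding upper_variation_def[of \<nu> "\<Union>i. A i"]
  proof (rule SUP_least)
    fix B assume "B \<in> {B \<in> sets borel. B \<subseteq> (\<Union>i. A i)}"
    then have B: "B \<in> sets borel" "B \<subseteq> (\<Union>i. A i)" by auto
    have "range (\<lambda>i. B \<inter> A i) \<subseteq> sets borel" using A B by auto
    moreover have "disjoint_family (\<lambda>i. B \<inter> A i)" using A(2) by (auto simp: disjoint_family_on_def)
    ultimately have "(\<lambda>i. \<nu> (B \<inter> A i)) sums \<nu> (\<Union>i. B \<inter> A i)"
      using \<nu> unfolding signed_borel_measure_def by blast
    also have "(\<Union>i. B \<inter> A i) = B" using B by auto
    finally have "(\<lambda>n. ennreal (\<Sum>i<n. \<nu> (B \<inter> A i))) \<longlonglongrightarrow> ennreal (\<nu> B)"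
      unfolding sums_def by (rule tendsto_ennrealI)
    moreover have "ennreal (\<Sum>i<n. \<nu> (B \<inter> A i)) \<le> (\<Sum>i. upper_variation \<nu> (A i))" for n
    proof -
      have "ennreal (\<Sum>i<n. \<nu> (B \<inter> A i)) \<le> (\<Sum>i<n. ennreal (\<nu> (B \<inter> A i)))" by (rule ennreal_sum_le)
      also have "\<dots> \<le> (\<Sum>i<n. upper_variation \<nu> (A i))"
        using A(1) B(1) by (intro sum_mono upper_variation_upper) auto
      also have "\<dots> \<le> (\<Sum>i. upper_variation \<nu> (A i))" by (intro sum_le_suminf) auto
      finally show ?thesis .
    qed
    ultimately show "ennreal (\<nu> B) \<le> (\<Sum>i. upper_variation \<nu> (A i))"
      by (intro LIMSEQ_le_const2) auto
  qed
qed

section \<open>The positive and negative parts as measures, and their masses\<close>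

lemma sets_positive_part [measurable_cong, simp]: "sets (positive_part \<nu>) = sets borel"
  and space_positive_part [simp]: "space (positive_part \<nu>) = UNIV"
proof -
  have "sets (positive_part \<nu>) = sigma_sets UNIV (sets borel)"
    unfolding positive_part_def by (rule sets_measure_of) simp
  then show "sets (positive_part \<nu>) = sets borel"
    using sets.sigma_sets_eq[of borel] by simp
  show "space (positive_part \<nu>) = UNIV" unfolding positive_part_def by (rule space_measure_of) simp
qed

lemma emeasure_positive_part:
  assumes \<nu>: "signed_borel_measure \<nu>" and A: "A \<in> sets borel"
  shows "emeasure (positive_part \<nu>) A = upper_variation \<nu> A"
proof (rule emeasure_measure_of[where \<Omega>=UNIV and A="sets borel"])
  show "positive_part \<nu> = measure_of UNIV (sets borel) (upper_variation \<nu>)"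
    unfolding positive_part_def upper_variation_def[abs_def] ..
  show "positive (sets (positive_part \<nu>)) (upper_variation \<nu>)"
    using upper_variation_empty[OF \<nu>] by (simp add: positive_def)
  show "countably_additive (sets (positive_part \<nu>)) (upper_variation \<nu>)"
    using upper_variation_suminf[OF \<nu>] by (auto simp: countably_additive_def)
qed (use A in auto)

text \<open>Together with the complement of their union the two sets form a partition of the space.
  Empty members are removed, since \<open>partition_on\<close> forbids them.\<close>

lemma abs_pair_le_variation:
  assumes \<nu>: "signed_borel_measure \<nu>" and AB: "A \<in> sets borel" "B \<in> sets borel" "A \<inter> B = {}"
  shows "ennreal \<bar>\<nu> A\<bar> + ennreal \<bar>\<nu> B\<bar> \<le> variation \<nu> UNIV"
proof -
  let ?f = "\<lambda>C. ennreal \<bar>\<nu> C\<bar>"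
  define \<P> where "\<P> = {A, B, - (A \<union> B)} - {{}}"
  have f0: "?f {} = 0" using signed_borel_measure_empty[OF \<nu>] by simp
  have "?f A + ?f B = sum ?f ({A, B} - {{}})"
  \<comment> \<open>Equal disjoint sets are empty. Without this case the set \<open>{A, B}\<close>
    might count a single term where the left side has two.\<close>
  proof (cases "A = B")
    case True
    with AB(3) show ?thesis using f0 by simp
  next
    case False
    then have "?f A + ?f B = sum ?f {A, B}" by simp
    also have "\<dots> = sum ?f ({A, B} - {{}})" using f0 by (intro sum.mono_neutral_right) auto
    finally show ?thesis .
  qed
  also have "\<dots> \<le> sum ?f \<P>" by (intro sum_mono2) (auto simp: \<P>_def)
  also have "\<dots> \<le> variation \<nu> UNIV"
    unfolding variation_def
  proof (rule SUP_upper)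
    have "partition_on UNIV \<P>"
    proof (rule partition_onI)
      show "\<Union>\<P> = UNIV" unfolding \<P>_def by blast
      fix p p' assume "p \<in> \<P>" "p' \<in> \<P>" "p \<noteq> p'"
      then show "disjnt p p'" using AB(3) unfolding \<P>_def disjnt_def by blast
    qed (simp add: \<P>_def)
    moreover have "\<P> \<subseteq> sets borel"
      using AB borel_comp[OF sets.Un[OF AB(1,2)]] unfolding \<P>_def by blast
    ultimately show "\<P> \<in> {\<P>. finite \<P> \<and> \<P> \<subseteq> sets borel \<and> partition_on UNIV \<P>}"
      by (simp add: \<P>_def)
  qed
  finally show ?thesis .
qed

text \<open>A competitor \<open>B\<close> for the positive part and a competitor \<open>C\<close>
  for the negative part may overlap. The values on the overlap cancel in \<nu> B - \<nu> C, which
  leaves the disjoint pair B - C and C - B.\<close>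

lemma emeasure_positive_negative_part_le:
  assumes \<nu>: "signed_borel_measure \<nu>"
  shows "emeasure (positive_part \<nu>) UNIV + emeasure (negative_part \<nu>) UNIV \<le> variation \<nu> UNIV"
proof -
  note \<nu>' = signed_borel_measure_uminus[OF \<nu>]
  have emp: "\<nu> {} = 0" by (rule signed_borel_measure_empty[OF \<nu>])
  have "ennreal (\<nu> B) + ennreal (- \<nu> C) \<le> variation \<nu> UNIV"
    if BC: "B \<in> sets borel" "C \<in> sets borel" for B C
  proof -
    have single: "ennreal \<bar>\<nu> D\<bar> \<le> variation \<nu> UNIV" if "D \<in> sets borel" for D
      using abs_pair_le_variation[OF \<nu> that, of "{}"] emp by simp
    consider "\<nu> B \<le> 0" | "0 \<le> \<nu> C" | "0 \<le> \<nu> B" "\<nu> C \<le> 0" by linarith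
    then show ?thesis
    proof cases
      case 1
      then have "ennreal (\<nu> B) + ennreal (- \<nu> C) \<le> ennreal \<bar>\<nu> C\<bar>"
        by (auto simp: ennreal_neg intro!: ennreal_leI)
      then show ?thesis using single[OF BC(2)] by (rule order_trans)
    next
      case 2
      then have "ennreal (\<nu> B) + ennreal (- \<nu> C) \<le> ennreal \<bar>\<nu> B\<bar>"
        by (auto simp: ennreal_neg intro!: ennreal_leI)
      then show ?thesis using single[OF BC(1)] by (rule order_trans)
    next
      case 3
      have "\<nu> B = \<nu> (B \<inter> C) + \<nu> (B - C)"
        using signed_borel_measure_Un[OF \<nu>, of "B \<inter> C" "B - C"] BC by (simp add: Int_Diff_Un Int_Diff_disjoint)
      moreover have "\<nu> C = \<nu> (B \<inter> C) + \<nu> (C - B)"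
        using signed_borel_measure_Un[OF \<nu>, of "C \<inter> B" "C - B"] BC
        by (simp add: Int_Diff_Un Int_Diff_disjoint Int_commute[of B C])
      ultimately have eq: "\<nu> B - \<nu> C = \<nu> (B - C) - \<nu> (C - B)" by simp
      have "ennreal (\<nu> B) + ennreal (- \<nu> C) = ennreal (\<nu> B - \<nu> C)"
        using 3 by (simp add: ennreal_plus[symmetric] del: ennreal_plus)
      also have "\<dots> \<le> ennreal (\<bar>\<nu> (B - C)\<bar> + \<bar>\<nu> (C - B)\<bar>)" unfolding eq by (intro ennreal_leI) simp
      also have "\<dots> = ennreal \<bar>\<nu> (B - C)\<bar> + ennreal \<bar>\<nu> (C - B)\<bar>" by (simp add: ennreal_plus)
      also have "\<dots> \<le> variation \<nu> UNIV" using BC by (intro abs_pair_le_variation[OF \<nu>]) auto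
      finally show ?thesis .
    qed
  qed
  then show ?thesis
    unfolding negative_part_def emeasure_positive_part[OF \<nu> borel_open[OF open_UNIV]]
      emeasure_positive_part[OF \<nu>' borel_open[OF open_UNIV]] upper_variation_def
    by (intro SUP_add_SUP_le) auto
qed

lemma sets_negative_part [measurable_cong, simp]: "sets (negative_part \<nu>) = sets borel"
  and space_negative_part [simp]: "space (negative_part \<nu>) = UNIV"
  by (simp_all add: negative_part_def)

text \<open>Since \<open>enn2real\<close> sends infinity to 0, the passage from extended to real
  masses relies on the finite variation.\<close>

lemma Jordan_parts_finite:
  assumes \<nu>: "signed_borel_measure \<nu>" and fin: "variation \<nu> UNIV < \<infinity>"
  shows "finite_measure (positive_part \<nu>)" "finite_measure (negative_part \<nu>)"
    "measure (positive_part \<nu>) UNIV + measure (negative_part \<nu>) UNIV \<le> total_variation \<nu>"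
proof -
  let ?p = "emeasure (positive_part \<nu>) UNIV" and ?n = "emeasure (negative_part \<nu>) UNIV"
  have le: "?p + ?n \<le> variation \<nu> UNIV" by (rule emeasure_positive_negative_part_le[OF \<nu>])
  then have lt: "?p + ?n < \<infinity>" using fin by (rule order_le_less_trans)
  then have "?p \<noteq> \<infinity>" "?n \<noteq> \<infinity>" by auto
  then show "finite_measure (positive_part \<nu>)" "finite_measure (negative_part \<nu>)"
    by (auto intro!: finite_measureI)
  have "measure (positive_part \<nu>) UNIV + measure (negative_part \<nu>) UNIV = enn2real (?p + ?n)"
    using lt by (simp add: measure_def enn2real_plus)
  also have "\<dots> \<le> total_variation \<nu>"
    unfolding total_variation_def using le fin by (intro enn2real_mono) auto
  finally show "measure (positive_part \<nu>) UNIV + measure (negative_part \<nu>) UNIV \<le> total_variation \<nu>" .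
qed

lemma total_variation_nonneg: "0 \<le> total_variation \<nu>"
  by (simp add: total_variation_def)

section \<open>Quadrature error of the kernel\<close>

lemma C0_space_measurable: "f \<in> C0_space \<Longrightarrow> f \<in> borel_measurable borel"
  by (simp add: C0_space_def borel_measurable_continuous_onI)

text \<open>The function is bounded by continuity on the compact set where its modulus is at least
  1, and by 1 elsewhere.\<close>

lemma C0_space_bounded:
  assumes "f \<in> C0_space"
  obtains B where "\<And>w. cmod (f w) \<le> B"
proof -
  let ?K = "{w. 1 \<le> cmod (f w)}"
  have "continuous_on UNIV f" "compact ?K"
    using assms unfolding C0_space_def vanishes_at_infinity_def by (simp_all only: mem_Collect_eq zero_less_one)
  then have "compact (f ` ?K)"
    by (metis compact_continuous_image continuous_on_subset subset_UNIV)
  then have "bounded (f ` ?K)" by (rule compact_imp_bounded)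
  then obtain B where B: "\<forall>z\<in>f ` ?K. cmod z \<le> B" unfolding bounded_iff ..
  have "cmod (f w) \<le> max 1 B" for w
    using B by (cases "1 \<le> cmod (f w)") (simp_all add: le_max_iff_disj)
  then show thesis by (rule that)
qed

lemma L1C0_norm_nonneg: "0 \<le> L1C0_norm \<mu> f"
  by (simp add: L1C0_norm_def le_max_iff_disj)

lemma integral_le_L1C0_norm: "(LINT w|\<mu>. cmod (f w)) \<le> L1C0_norm \<mu> f"
  by (simp add: L1C0_norm_def)

text \<open>A real supremum is an upper bound only for a set that is bounded above, hence the
  hypothesis on \<open>B\<close>.\<close>

lemma norm_le_L1C0_norm:
  assumes "\<And>w. cmod (f w) \<le> B"
  shows "cmod (f w) \<le> L1C0_norm \<mu> f"
proof -
  have "cmod (f w) \<le> (SUP w. cmod (f w))"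
    by (rule cSUP_upper) (use assms in \<open>auto intro!: bdd_aboveI\<close>)
  then show ?thesis by (simp add: L1C0_norm_def le_max_iff_disj)
qed

lemma norm_le_L1C0_norm_C0: "f \<in> C0_space \<Longrightarrow> cmod (f w) \<le> L1C0_norm \<mu> f"
  by (metis C0_space_bounded norm_le_L1C0_norm)

lemma norm_diff_le_L1C0_dist:
  assumes "f \<in> C0_space" "g \<in> C0_space"
  shows "cmod (f w - g w) \<le> L1C0_dist \<mu> f g"
proof -
  obtain B C where "\<And>w. cmod (f w) \<le> B" "\<And>w. cmod (g w) \<le> C"
    using C0_space_bounded[OF assms(1)] C0_space_bounded[OF assms(2)] by metis
  then have "cmod (f w - g w) \<le> B + C" for w
    using norm_triangle_ineq4[of "f w" "g w"] by (meson add_mono order_trans)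
  then show ?thesis unfolding L1C0_dist_def by (rule norm_le_L1C0_norm)
qed

text \<open>Integrable times bounded. The measure is left general so that \<mu> and both Jordan
  parts of \<nu> are covered.\<close>

lemma integrable_mult_cnj:
  fixes f g :: "'w::topological_space \<Rightarrow> complex"
  assumes "sets \<kappa> = sets borel" "integrable \<kappa> f" "g \<in> C0_space"
  shows "integrable \<kappa> (\<lambda>w. f w * cnj (g w))"
proof -
  obtain B where B: "\<And>w. cmod (g w) \<le> B" using C0_space_bounded[OF assms(3)] by metis
  have g: "g \<in> borel_measurable \<kappa>"
    using C0_space_measurable[OF assms(3)] measurable_cong_sets[OF assms(1) refl] by blast
  have f: "f \<in> borel_measurable \<kappa>" using assms(2) by (rule borel_measurable_integrable)
  have c: "(\<lambda>w. cnj (g w)) \<in> borel_measurable \<kappa>"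
    by (rule borel_measurable_continuous_on[OF _ g]) (intro continuous_intros)
  show ?thesis
  proof (rule Bochner_Integration.integrable_bound)
    show "integrable \<kappa> (\<lambda>w. B * cmod (f w))" using assms(2) by auto
    show "(\<lambda>w. f w * cnj (g w)) \<in> borel_measurable \<kappa>" using f c by (rule borel_measurable_times)
    have "cmod (f w) * cmod (g w) \<le> \<bar>B\<bar> * cmod (f w)" for w
      using mult_left_mono[of "cmod (g w)" "\<bar>B\<bar>" "cmod (f w)"] B[of w] by (simp add: mult.commute)
    then show "AE w in \<kappa>. cmod (f w * cnj (g w)) \<le> norm (B * cmod (f w))"
      by (simp add: norm_mult abs_mult)
  qed
qed

lemma C0_space_integrable_finite:
  fixes f :: "'w::topological_space \<Rightarrow> complex"
  assumes "sets \<kappa> = sets borel" "finite_measure \<kappa>" "f \<in> C0_space"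
  shows "integrable \<kappa> f"
proof -
  obtain B where B: "\<And>w. cmod (f w) \<le> B" using C0_space_bounded[OF assms(3)] by metis
  have "f \<in> borel_measurable \<kappa>"
    using C0_space_measurable[OF assms(3)] measurable_cong_sets[OF assms(1) refl] by blast
  then show ?thesis using B by (intro finite_measure.integrable_const_bound[OF assms(2), of _ B]) auto
qed

lemma norm_integral_le_integral:
  fixes f :: "'w \<Rightarrow> 'b::{banach, second_countable_topology}"
  assumes "integrable \<kappa> f" "integrable \<kappa> g" "\<And>w. norm (f w) \<le> g w"
  shows "norm (integral\<^sup>L \<kappa> f) \<le> integral\<^sup>L \<kappa> g"
proof -
  have "norm (integral\<^sup>L \<kappa> f) \<le> (LINT w|\<kappa>. norm (f w))" by (rule integral_norm_bound)
  also have "\<dots> \<le> integral\<^sup>L \<kappa> g" using assms by (intro integral_mono) auto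
  finally show ?thesis .
qed

lemma norm_integral_le_finite:
  fixes f :: "'w \<Rightarrow> complex"
  assumes "finite_measure \<kappa>" "space \<kappa> = UNIV" "integrable \<kappa> f" "\<And>w. cmod (f w) \<le> c"
  shows "cmod (integral\<^sup>L \<kappa> f) \<le> c * measure \<kappa> UNIV"
proof -
  interpret finite_measure \<kappa> by fact
  have "cmod (integral\<^sup>L \<kappa> f) \<le> (LINT w|\<kappa>. c)"
    using assms(3,4) by (intro norm_integral_le_integral) auto
  then show ?thesis using assms(2) by (simp add: mult.commute)
qed

lemma norm_mult_cnj_diff_le:
  fixes f g p q :: complex
  assumes "cmod g \<le> a" "cmod p \<le> b"
  shows "cmod (f * cnj g - p * cnj q) \<le> cmod (f - p) * a + b * cmod (g - q)"
proof -
  have "f * cnj g - p * cnj q = (f - p) * cnj g + p * cnj (g - q)" by (simp add: algebra_simps)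
  also have "cmod \<dots> \<le> cmod ((f - p) * cnj g) + cmod (p * cnj (g - q))" by (rule norm_triangle_ineq)
  also have "\<dots> = cmod (f - p) * cmod g + cmod p * cmod (g - q)"
    by (simp only: norm_mult complex_mod_cnj)
  also have "\<dots> \<le> cmod (f - p) * a + b * cmod (g - q)"
    using assms by (intro add_mono mult_left_mono mult_right_mono) auto
  finally show ?thesis .
qed

section \<open>Polarisation of the quadrature identity\<close>

lemma complex_polarization:
  fixes f g :: complex
  shows "4 * (f * cnj g) = complex_of_real ((cmod (f + 1 * g))\<^sup>2) - complex_of_real ((cmod (f + - 1 * g))\<^sup>2)
    + \<i> * complex_of_real ((cmod (f + \<i> * g))\<^sup>2) - \<i> * complex_of_real ((cmod (f + - \<i> * g))\<^sup>2)"
  unfolding complex_norm_square by (simp add: algebra_simps)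

text \<open>Writing the four squares as values of one function of \<open>c\<close> makes their
  integrability a single hypothesis, and matches the combinations P + c Q that stay in the
  subspace.\<close>

lemma integral_polarization:
  fixes f g :: "'w \<Rightarrow> complex"
  assumes "\<And>c. integrable \<kappa> (\<lambda>w. (cmod (f w + c * g w))\<^sup>2)"
  defines "S \<equiv> (\<lambda>c. complex_of_real (LINT w|\<kappa>. (cmod (f w + c * g w))\<^sup>2))"
  shows "4 * (LINT w|\<kappa>. f w * cnj (g w)) = S 1 - S (- 1) + \<i> * S \<i> - \<i> * S (- \<i>)"
proof -
  define F where "F c w = complex_of_real ((cmod (f w + c * g w))\<^sup>2)" for c w
  have F: "integrable \<kappa> (F c)" for c
    unfolding F_def[abs_def] using assms(1)[of c] by (rule integrable_of_real)
  have S: "S c = integral\<^sup>L \<kappa> (F c)" for c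
    unfolding S_def F_def[abs_def] by (rule integral_complex_of_real[symmetric])
  have "4 * (LINT w|\<kappa>. f w * cnj (g w)) = (LINT w|\<kappa>. 4 * (f w * cnj (g w)))" by simp
  also have "\<dots> = (LINT w|\<kappa>. F 1 w - F (- 1) w + \<i> * F \<i> w - \<i> * F (- \<i>) w)"
    by (simp only: complex_polarization F_def)
  also have "\<dots> = S 1 - S (- 1) + \<i> * S \<i> - \<i> * S (- \<i>)"
    unfolding S using F by simp
  finally show ?thesis .
qed

lemma complex_fun_subspaceD:
  assumes "complex_fun_subspace V"
  shows "(\<lambda>_. 0) \<in> V" "P \<in> V \<Longrightarrow> Q \<in> V \<Longrightarrow> (\<lambda>w. P w + c * Q w) \<in> V"
proof -
  interpret m: Modules.module "\<lambda>c (f :: 'a \<Rightarrow> complex) w. c * f w"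
    by unfold_locales (auto simp: algebra_simps plus_fun_def)
  have V: "m.subspace V" using assms by (simp add: complex_fun_subspace_def)
  show "(\<lambda>_. 0) \<in> V" using m.subspace_0[OF V] by (simp add: zero_fun_def)
  show "(\<lambda>w. P w + c * Q w) \<in> V" if "P \<in> V" "Q \<in> V"
    using m.subspace_add[OF V that(1) m.subspace_scale[OF V that(2), of c]] by (simp add: plus_fun_def)
qed

text \<open>Each P + c Q lies in \<open>V\<close>, so its squared modulus has equal integrals. Those
  squares are integrable against \<mu> as products of an integrable and a bounded function, and
  against the Jordan parts because these are finite measures.\<close>

lemma quadrature_measure_product:
  assumes \<mu>: "sets \<mu> = sets borel" and V: "V \<subseteq> L1C0_space \<mu>" "complex_fun_subspace V"
    and q: "quadrature_measure \<mu> V \<nu>" and PQ: "P \<in> V" "Q \<in> V"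
  shows "signed_integral \<nu> (\<lambda>w. P w * cnj (Q w)) = (LINT w|\<mu>. P w * cnj (Q w))"
proof -
  have \<nu>: "signed_borel_measure \<nu>" "variation \<nu> UNIV < \<infinity>"
    using q by (auto simp: quadrature_measure_def)
  define R where "R c w = P w + c * Q w" for c w
  have R: "R c \<in> V" for c unfolding R_def[abs_def] by (rule complex_fun_subspaceD(2)[OF V(2) PQ])
  have int: "integrable \<kappa> (\<lambda>w. (cmod (P w + c * Q w))\<^sup>2)"
    if "sets \<kappa> = sets borel" "integrable \<kappa> (R c)" for \<kappa> c
  proof -
    have "integrable \<kappa> (\<lambda>w. R c w * cnj (R c w))"
      using R V(1) that by (intro integrable_mult_cnj) (auto simp: L1C0_space_def)
    then have "integrable \<kappa> (\<lambda>w. Re (R c w * cnj (R c w)))" by (rule integrable_Re)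
    then show ?thesis
      by (simp only: complex_norm_square[symmetric] Re_complex_of_real R_def)
  qed
  have R\<mu>: "integrable \<mu> (R c)" and RC: "R c \<in> C0_space" for c
    using R V(1) by (auto simp: L1C0_space_def)
  note fin = Jordan_parts_finite(1,2)[OF \<nu>]
  note pol = integral_polarization[OF int[OF \<mu> R\<mu>]]
    integral_polarization[OF int[OF sets_positive_part C0_space_integrable_finite[OF sets_positive_part fin(1) RC]]]
    integral_polarization[OF int[OF sets_negative_part C0_space_integrable_finite[OF sets_negative_part fin(2) RC]]]
  have quad: "complex_of_real (LINT w|\<mu>. (cmod (P w + c * Q w))\<^sup>2) =
      complex_of_real (LINT w|positive_part \<nu>. (cmod (P w + c * Q w))\<^sup>2) -
      complex_of_real (LINT w|negative_part \<nu>. (cmod (P w + c * Q w))\<^sup>2)" for c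
  proof -
    have "signed_integral \<nu> (\<lambda>w. (cmod (R c w))\<^sup>2) = (LINT w|\<mu>. (cmod (R c w))\<^sup>2)"
      using q R[of c] by (auto simp: quadrature_measure_def)
    then show ?thesis unfolding of_real_diff[symmetric] by (simp add: signed_integral_def R_def)
  qed
  have "4 * signed_integral \<nu> (\<lambda>w. P w * cnj (Q w)) = 4 * (LINT w|\<mu>. P w * cnj (Q w))"
    unfolding signed_integral_def right_diff_distrib[of 4] pol quad by (simp add: algebra_simps)
  then show ?thesis by simp
qed

text \<open>One pointwise bound is used twice: integrated against \<mu>, where the differences are
  small in the mean, and taken uniformly against the two finite parts of \<nu>.\<close>

lemma mult_cnj_integral_diff_le:
  assumes \<mu>: "sets \<mu> = sets borel" and \<nu>: "signed_borel_measure \<nu>" "variation \<nu> UNIV < \<infinity>"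
    and fg: "f \<in> L1C0_space \<mu>" "g \<in> L1C0_space \<mu>" "P \<in> L1C0_space \<mu>" "Q \<in> L1C0_space \<mu>"
    and a: "L1C0_norm \<mu> f \<le> a" "L1C0_norm \<mu> g \<le> a"
    and d: "L1C0_dist \<mu> f P \<le> d" "L1C0_dist \<mu> g Q \<le> d"
  shows "cmod ((LINT w|\<mu>. f w * cnj (g w)) - (LINT w|\<mu>. P w * cnj (Q w))) \<le> d * a + (a + d) * d"
    and "cmod (signed_integral \<nu> (\<lambda>w. f w * cnj (g w)) - signed_integral \<nu> (\<lambda>w. P w * cnj (Q w)))
      \<le> total_variation \<nu> * (d * a + (a + d) * d)"
proof -
  have int\<mu>: "integrable \<mu> f" "integrable \<mu> g" "integrable \<mu> P" "integrable \<mu> Q"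
    and C0: "f \<in> C0_space" "g \<in> C0_space" "P \<in> C0_space" "Q \<in> C0_space"
    using fg by (auto simp: L1C0_space_def)
  have a0: "0 \<le> a" using a(1) L1C0_norm_nonneg[of \<mu> f] by simp
  have d0: "0 \<le> d" using d(1) L1C0_norm_nonneg unfolding L1C0_dist_def by (rule order_trans[rotated])
  have fb: "cmod (f w) \<le> a" and gb: "cmod (g w) \<le> a" for w
    using norm_le_L1C0_norm_C0[OF C0(1), of w \<mu>] norm_le_L1C0_norm_C0[OF C0(2), of w \<mu>] a by auto
  have fP: "cmod (f w - P w) \<le> d" and gQ: "cmod (g w - Q w) \<le> d" for w
    using norm_diff_le_L1C0_dist[OF C0(1,3), of w \<mu>] norm_diff_le_L1C0_dist[OF C0(2,4), of w \<mu>] d by auto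
  have Pb: "cmod (P w) \<le> a + d" for w
    using norm_triangle_ineq4[of "f w" "f w - P w"] fb[of w] fP[of w] by simp
  let ?h = "\<lambda>w. f w * cnj (g w) - P w * cnj (Q w)"
  have h: "cmod (?h w) \<le> cmod (f w - P w) * a + (a + d) * cmod (g w - Q w)" for w
    using gb Pb by (rule norm_mult_cnj_diff_le)
  have ih: "integrable \<mu> (\<lambda>w. f w * cnj (g w))" "integrable \<mu> (\<lambda>w. P w * cnj (Q w))"
    using int\<mu> C0 by (auto intro!: integrable_mult_cnj[OF \<mu>])
  have "cmod (integral\<^sup>L \<mu> ?h) \<le> (LINT w|\<mu>. cmod (f w - P w) * a + (a + d) * cmod (g w - Q w))"
    using int\<mu> ih h by (intro norm_integral_le_integral) auto
  also have "\<dots> = (LINT w|\<mu>. cmod (f w - P w)) * a + (a + d) * (LINT w|\<mu>. cmod (g w - Q w))"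
    using int\<mu> by simp
  also have "\<dots> \<le> d * a + (a + d) * d"
    using integral_le_L1C0_norm[of \<mu> "\<lambda>w. f w - P w"] integral_le_L1C0_norm[of \<mu> "\<lambda>w. g w - Q w"]
      d a0 d0 by (intro add_mono mult_left_mono mult_right_mono) (auto simp: L1C0_dist_def)
  finally show "cmod ((LINT w|\<mu>. f w * cnj (g w)) - (LINT w|\<mu>. P w * cnj (Q w))) \<le> d * a + (a + d) * d"
    using ih by simp
  let ?c = "d * a + (a + d) * d"
  have hc: "cmod (?h w) \<le> ?c" for w
  proof -
    have "cmod (f w - P w) * a + (a + d) * cmod (g w - Q w) \<le> ?c"
      using fP[of w] gQ[of w] a0 d0 by (intro add_mono mult_left_mono mult_right_mono) auto
    with h[of w] show ?thesis by (rule order_trans)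
  qed
  note J = Jordan_parts_finite[OF \<nu>]
  \<comment> \<open>Stated for any finite Borel measure, to be applied to the positive and to the
    negative part.\<close>
  have \<kappa>: "integrable \<kappa> (\<lambda>w. f w * cnj (g w))" "integrable \<kappa> (\<lambda>w. P w * cnj (Q w))"
    "cmod (integral\<^sup>L \<kappa> ?h) \<le> ?c * measure \<kappa> UNIV"
    if "sets \<kappa> = sets borel" "finite_measure \<kappa>" "space \<kappa> = UNIV" for \<kappa>
  proof -
    show i: "integrable \<kappa> (\<lambda>w. f w * cnj (g w))" "integrable \<kappa> (\<lambda>w. P w * cnj (Q w))"
      by (rule integrable_mult_cnj[OF that(1) C0_space_integrable_finite[OF that(1,2) C0(1)] C0(2)]
          integrable_mult_cnj[OF that(1) C0_space_integrable_finite[OF that(1,2) C0(3)] C0(4)])+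
    show "cmod (integral\<^sup>L \<kappa> ?h) \<le> ?c * measure \<kappa> UNIV"
      using i hc that by (intro norm_integral_le_finite) auto
  qed
  note p = \<kappa>[OF sets_positive_part J(1) space_positive_part]
  note n = \<kappa>[OF sets_negative_part J(2) space_negative_part]
  have "signed_integral \<nu> (\<lambda>w. f w * cnj (g w)) - signed_integral \<nu> (\<lambda>w. P w * cnj (Q w)) =
      integral\<^sup>L (positive_part \<nu>) ?h - integral\<^sup>L (negative_part \<nu>) ?h"
    unfolding signed_integral_def Bochner_Integration.integral_diff[OF p(1,2)]
      Bochner_Integration.integral_diff[OF n(1,2)] by simp
  also have "cmod \<dots> \<le> ?c * measure (positive_part \<nu>) UNIV + ?c * measure (negative_part \<nu>) UNIV"
    using p(3) n(3) norm_triangle_ineq4 by (meson add_mono order_trans)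
  also have "\<dots> = ?c * (measure (positive_part \<nu>) UNIV + measure (negative_part \<nu>) UNIV)"
    by (simp add: distrib_left)
  also have "\<dots> \<le> ?c * total_variation \<nu>"
    using J(3) a0 d0 by (intro mult_left_mono) auto
  finally show "cmod (signed_integral \<nu> (\<lambda>w. f w * cnj (g w)) - signed_integral \<nu> (\<lambda>w. P w * cnj (Q w)))
      \<le> total_variation \<nu> * ?c" by (simp only: mult.commute)
qed

lemma kernel_quadrature_error:
  assumes \<mu>: "sets \<mu> = sets borel" and V: "V \<subseteq> L1C0_space \<mu>" "complex_fun_subspace V"
    and q: "quadrature_measure \<mu> V \<nu>"
    and fg: "f \<in> L1C0_space \<mu>" "g \<in> L1C0_space \<mu>"
    and a: "L1C0_norm \<mu> f \<le> a" "L1C0_norm \<mu> g \<le> a"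
    and e: "L1C0_setdist \<mu> f V \<le> e" "L1C0_setdist \<mu> g V \<le> e"
  shows "cmod ((LINT w|\<mu>. f w * cnj (g w)) - signed_integral \<nu> (\<lambda>w. f w * cnj (g w)))
    \<le> 3 * (1 + total_variation \<nu>) * a * e"
    and "0 \<le> e"
proof -
  let ?T = "total_variation \<nu>"
  have \<nu>: "signed_borel_measure \<nu>" "variation \<nu> UNIV < \<infinity>"
    using q by (auto simp: quadrature_measure_def)
  note V0 = complex_fun_subspaceD(1)[OF V(2)]
  have dist0: "0 \<le> L1C0_dist \<mu> h P" for h P unfolding L1C0_dist_def by (rule L1C0_norm_nonneg)
  then have bdd: "bdd_below ((\<lambda>P. L1C0_dist \<mu> h P) ` V)" for h by (auto intro!: bdd_belowI)
  have sd0: "0 \<le> L1C0_setdist \<mu> h V" for h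
    unfolding L1C0_setdist_def using V0 dist0 by (intro cINF_greatest) auto
  then show e0: "0 \<le> e" using e(1) by (rule order_trans)
  have a0: "0 \<le> a" using a(1) L1C0_norm_nonneg[of \<mu> f] by simp
  \<comment> \<open>Since 0 lies in \<open>V\<close>, the distance never exceeds the norm. Capping
    \<open>d\<close> by \<open>a\<close> keeps the bound a + d for the approximants below 2a,
    however large \<open>e\<close> is.\<close>
  define d where "d = min a e"
  have d: "0 \<le> d" "d \<le> a" "d \<le> e" using a0 e0 by (auto simp: d_def)
  have sda: "L1C0_setdist \<mu> h V \<le> L1C0_norm \<mu> h" for h
    unfolding L1C0_setdist_def using cINF_lower[OF bdd V0, of h] by (simp add: L1C0_dist_def)
  have approx: "\<exists>P\<in>V. L1C0_dist \<mu> h P < d + \<delta>"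
    if "L1C0_setdist \<mu> h V \<le> e" "L1C0_norm \<mu> h \<le> a" "0 < \<delta>" for h \<delta>
  proof -
    have "(INF P\<in>V. L1C0_dist \<mu> h P) < d + \<delta>"
      using that sda[of h] by (auto simp: d_def L1C0_setdist_def)
    then show ?thesis using cInf_lessD[of "(\<lambda>P. L1C0_dist \<mu> h P) ` V"] V0 by blast
  qed
  \<comment> \<open>The infimum defining the distance need not be attained, so the bound is proved
    with a margin \<delta>, which then tends to 0 from the right.\<close>
  let ?E = "\<lambda>\<delta>. (1 + ?T) * ((d + \<delta>) * a + (a + (d + \<delta>)) * (d + \<delta>))"
  let ?D = "(LINT w|\<mu>. f w * cnj (g w)) - signed_integral \<nu> (\<lambda>w. f w * cnj (g w))"
  have "cmod ?D \<le> ?E \<delta>" if \<delta>: "0 < \<delta>" for \<delta>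
  proof -
    obtain P Q where PQ: "P \<in> V" "Q \<in> V" "L1C0_dist \<mu> f P \<le> d + \<delta>" "L1C0_dist \<mu> g Q \<le> d + \<delta>"
      using approx[OF e(1) a(1) \<delta>] approx[OF e(2) a(2) \<delta>] by (meson less_imp_le)
    then have "P \<in> L1C0_space \<mu>" "Q \<in> L1C0_space \<mu>" using V(1) by auto
    note b = mult_cnj_integral_diff_le[OF \<mu> \<nu> fg this a PQ(3,4)]
    have "?D = ((LINT w|\<mu>. f w * cnj (g w)) - (LINT w|\<mu>. P w * cnj (Q w))) -
        (signed_integral \<nu> (\<lambda>w. f w * cnj (g w)) - signed_integral \<nu> (\<lambda>w. P w * cnj (Q w)))"
      using quadrature_measure_product[OF \<mu> V q PQ(1,2)] by simp
    also have "cmod \<dots> \<le> ((d + \<delta>) * a + (a + (d + \<delta>)) * (d + \<delta>)) + ?T * ((d + \<delta>) * a + (a + (d + \<delta>)) * (d + \<delta>))"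
      using b norm_triangle_ineq4 by (meson add_mono order_trans)
    also have "\<dots> = ?E \<delta>" by (simp add: distrib_right)
    finally show ?thesis .
  qed
  then have ev: "eventually (\<lambda>\<delta>. cmod ?D \<le> ?E \<delta>) (at_right 0)"
    using eventually_at_right_less[of "0::real"] by (auto elim: eventually_mono)
  have "(?E \<longlongrightarrow> (1 + ?T) * ((d + 0) * a + (a + (d + 0)) * (d + 0))) (at_right 0)"
    by (intro tendsto_intros)
  from tendsto_lowerbound[OF this ev]
  have "cmod ?D \<le> (1 + ?T) * (d * a + (a + d) * d)" by simp
  \<comment> \<open>Here the 3 arises: one a e from the first term, two from the second by d \<le>
    a.\<close>
  also have "\<dots> \<le> (1 + ?T) * (e * a + (a + a) * e)"
    using d a0 e0 total_variation_nonneg[of \<nu>]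
    by (intro mult_left_mono add_mono mult_mono) auto
  also have "\<dots> = 3 * (1 + ?T) * a * e" by (simp add: algebra_simps)
  finally show "cmod ?D \<le> 3 * (1 + ?T) * a * e" .
qed

section \<open>Perturbation of the kernel matrix\<close>

lemma hermitian_mat_add:
  assumes "A \<in> carrier_mat n n" "B \<in> carrier_mat n n" "hermitian_mat A" "hermitian_mat B"
  shows "hermitian_mat (A + B)"
proof (rule hermitian_matI)
  show "A + B \<in> carrier_mat n n" using assms by simp
  fix i j assume "i < n" "j < n"
  then show "(A + B) $$ (i, j) = cnj ((A + B) $$ (j, i))"
    using assms(1,2) hermitian_matD[OF assms(3,1), of i j] hermitian_matD[OF assms(4,2), of i j] by simp
qed

lemma hermitian_mat_smult:
  assumes "A \<in> carrier_mat n n" "hermitian_mat A"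
  shows "hermitian_mat (complex_of_real r \<cdot>\<^sub>m A)"
proof (rule hermitian_matI)
  show "complex_of_real r \<cdot>\<^sub>m A \<in> carrier_mat n n" using assms by simp
  fix i j assume "i < n" "j < n"
  then show "(complex_of_real r \<cdot>\<^sub>m A) $$ (i, j) = cnj ((complex_of_real r \<cdot>\<^sub>m A) $$ (j, i))"
    using assms(1) hermitian_matD[OF assms(2,1), of i j] by simp
qed

text \<open>Reduces Hermitian symmetry and quadratic forms of differences to those of sums and
  multiples.\<close>

lemma minus_mat_eq_add_smult:
  fixes A B :: "complex mat"
  assumes "A \<in> carrier_mat n n" "B \<in> carrier_mat n n"
  shows "A - B = A + complex_of_real (- 1) \<cdot>\<^sub>m B"
  using assms by (intro eq_matI) auto

lemma hermitian_mat_minus: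
  assumes "A \<in> carrier_mat n n" "B \<in> carrier_mat n n" "hermitian_mat A" "hermitian_mat B"
  shows "hermitian_mat (A - B)"
  unfolding minus_mat_eq_add_smult[OF assms(1,2)]
  using assms by (intro hermitian_mat_add[of _ n] hermitian_mat_smult[of _ n]) auto

lemma hermitian_mat_one: "hermitian_mat (1\<^sub>m n)"
  by (rule hermitian_matI[of _ n]) auto

lemma quadratic_form_add:
  fixes A B :: "complex mat"
  assumes "A \<in> carrier_mat n n" "B \<in> carrier_mat n n" "v \<in> carrier_vec n"
  shows "((A + B) *\<^sub>v v) \<bullet>c v = (A *\<^sub>v v) \<bullet>c v + (B *\<^sub>v v) \<bullet>c v"
  using assms by (simp add: add_mult_distrib_mat_vec[of _ n n] add_scalar_prod_distrib[of _ n])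

lemma quadratic_form_smult:
  fixes A :: "complex mat"
  assumes "A \<in> carrier_mat n n" "v \<in> carrier_vec n"
  shows "((c \<cdot>\<^sub>m A) *\<^sub>v v) \<bullet>c v = c * ((A *\<^sub>v v) \<bullet>c v)"
proof -
  have "c \<cdot>\<^sub>m A \<in> carrier_mat n n" using assms by simp
  from quadratic_form_sum[OF this assms(2)] show ?thesis
    unfolding quadratic_form_sum[OF assms] using assms by (simp add: sum_distrib_left mult.assoc)
qed

lemma Re_quadratic_form_minus:
  fixes A B :: "complex mat"
  assumes "A \<in> carrier_mat n n" "B \<in> carrier_mat n n" "v \<in> carrier_vec n"
  shows "Re (((A - B) *\<^sub>v v) \<bullet>c v) = Re ((A *\<^sub>v v) \<bullet>c v) - Re ((B *\<^sub>v v) \<bullet>c v)"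
proof -
  have "complex_of_real (- 1) \<cdot>\<^sub>m B \<in> carrier_mat n n" using assms by simp
  then show ?thesis
    unfolding minus_mat_eq_add_smult[OF assms(1,2)]
    by (simp only: quadratic_form_add[OF assms(1) _ assms(3)] quadratic_form_smult[OF assms(2,3)]) simp
qed

lemma Re_quadratic_form_add_identity:
  assumes "A \<in> carrier_mat n n" "v \<in> carrier_vec n"
  shows "Re (((A + complex_of_real r \<cdot>\<^sub>m 1\<^sub>m n) *\<^sub>v v) \<bullet>c v) = Re ((A *\<^sub>v v) \<bullet>c v) + r * Re (v \<bullet>c v)"
proof -
  have "complex_of_real r \<cdot>\<^sub>m 1\<^sub>m n \<in> carrier_mat n n" by simp
  from quadratic_form_add[OF assms(1) this assms(2)] show ?thesis
    using assms(2) by (simp add: quadratic_form_smult[OF one_carrier_mat assms(2)])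
qed

lemma loewner_leI:
  assumes "A \<in> carrier_mat n n" "B \<in> carrier_mat n n" "hermitian_mat A" "hermitian_mat B"
    and "\<And>v. v \<in> carrier_vec n \<Longrightarrow> Re ((A *\<^sub>v v) \<bullet>c v) \<le> Re ((B *\<^sub>v v) \<bullet>c v)"
  shows "A \<lless> B"
proof -
  have "pos_semidef (B - A)"
    unfolding pos_semidef_def
  proof (intro conjI ballI)
    show "hermitian_mat (B - A)" using assms by (intro hermitian_mat_minus[of _ n])
    fix v :: "complex vec" assume "v \<in> carrier_vec (dim_row (B - A))"
    then have v: "v \<in> carrier_vec n" using assms by auto
    show "0 \<le> Re (((B - A) *\<^sub>v v) \<bullet>c v)"
      using Re_quadratic_form_minus[OF assms(2,1) v] assms(5)[OF v] by simp
  qed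
  then show ?thesis using assms by (auto simp: loewner_le_def)
qed

section \<open>Bounds from the size of the entries, and Gram matrices\<close>

lemma euclidean_norm_vec_eq:
  assumes "v \<in> carrier_vec n"
  shows "euclidean_norm_vec v = sqrt (\<Sum>i<n. (cmod (v $ i))\<^sup>2)"
  unfolding euclidean_norm_vec_def cscalar_prod_self[OF assms] by (simp only: Re_complex_of_real)

lemma Re_cscalar_prod_self: "Re (v \<bullet>c v) = (euclidean_norm_vec v)\<^sup>2"
  unfolding euclidean_norm_vec_eq[OF carrier_vec_dim_vec] cscalar_prod_self[OF carrier_vec_dim_vec]
  by (simp add: sum_nonneg del: of_real_sum of_real_power)

text \<open>Cauchy-Schwarz against the all-ones vector. This is the origin of the factor
  \<open>M\<close> in \<open>eps\<close>.\<close>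

lemma sum_norm_le_euclidean_norm:
  assumes "v \<in> carrier_vec n"
  shows "(\<Sum>i<n. cmod (v $ i))\<^sup>2 \<le> real n * (euclidean_norm_vec v)\<^sup>2"
  using Cauchy_Schwarz_ineq_sum[of "\<lambda>_. 1" "\<lambda>i. cmod (v $ i)" "{..<n}"]
  by (simp add: euclidean_norm_vec_eq[OF assms] sum_nonneg)

lemma quadratic_form_le_of_entries_le:
  fixes A :: "complex mat"
  assumes A: "A \<in> carrier_mat n n" and c: "\<And>i j. i < n \<Longrightarrow> j < n \<Longrightarrow> cmod (A $$ (i, j)) \<le> c"
    and c0: "0 \<le> c" and v: "v \<in> carrier_vec n"
  shows "\<bar>Re ((A *\<^sub>v v) \<bullet>c v)\<bar> \<le> real n * c * Re (v \<bullet>c v)"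
proof -
  have "\<bar>Re ((A *\<^sub>v v) \<bullet>c v)\<bar> \<le> cmod ((A *\<^sub>v v) \<bullet>c v)" by (rule abs_Re_le_cmod)
  also have "\<dots> \<le> (\<Sum>i<n. \<Sum>j<n. cmod (A $$ (i, j) * v $ j * cnj (v $ i)))"
    unfolding quadratic_form_sum[OF A v] by (rule order_trans[OF norm_sum sum_mono[OF norm_sum]])
  also have "\<dots> \<le> (\<Sum>i<n. \<Sum>j<n. c * cmod (v $ j) * cmod (v $ i))"
    using c by (auto simp: norm_mult intro!: sum_mono mult_right_mono)
  also have "\<dots> = c * (\<Sum>i<n. cmod (v $ i))\<^sup>2"
    by (simp add: power2_eq_square sum_product sum_distrib_left mult_ac)
  also have "\<dots> \<le> c * (real n * (euclidean_norm_vec v)\<^sup>2)"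
    using sum_norm_le_euclidean_norm[OF v] c0 by (rule mult_left_mono)
  finally show ?thesis by (simp add: Re_cscalar_prod_self mult_ac)
qed

text \<open>For a unit vector each of the \<open>n\<close> rows contributes at most
  \<open>c\<^sup>2 * n\<close> to the squared length of the image.\<close>

lemma spectral_norm_le_of_entries_le:
  fixes A :: "complex mat"
  assumes A: "A \<in> carrier_mat n n" and c: "\<And>i j. i < n \<Longrightarrow> j < n \<Longrightarrow> cmod (A $$ (i, j)) \<le> c"
    and c0: "0 \<le> c" and n: "1 \<le> n"
  shows "spectral_norm A \<le> real n * c"
  unfolding spectral_norm_def
proof (rule cSUP_least)
  \<comment> \<open>The supremum bound needs a nonempty unit sphere, which exists because n \<ge>
    1.\<close>
  have "unit_vec n 0 \<in> carrier_vec n" by simp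
  moreover have "euclidean_norm_vec (unit_vec n 0) = 1"
  proof -
    have "(\<Sum>i<n. (cmod (unit_vec n 0 $ i))\<^sup>2) = (\<Sum>i<n. if i = 0 then 1 else 0)"
      by (intro sum.cong) auto
    then show ?thesis using n by (simp add: euclidean_norm_vec_eq[of _ n])
  qed
  ultimately show "{v \<in> carrier_vec (dim_col A). euclidean_norm_vec v = 1} \<noteq> {}" using A by blast
next
  fix v assume "v \<in> {v \<in> carrier_vec (dim_col A). euclidean_norm_vec v = 1}"
  then have v: "v \<in> carrier_vec n" "euclidean_norm_vec v = 1" using A by auto
  let ?S = "\<Sum>j<n. cmod (v $ j)"
  have Av: "A *\<^sub>v v \<in> carrier_vec n" using A v by simp
  have row: "(cmod ((A *\<^sub>v v) $ i))\<^sup>2 \<le> c\<^sup>2 * ?S\<^sup>2" if i: "i < n" for i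
  proof -
    have "(A *\<^sub>v v) $ i = (\<Sum>j<n. A $$ (i, j) * v $ j)"
      using A v(1) i by (auto simp: scalar_prod_def atLeast0LessThan intro!: sum.cong)
    then have "cmod ((A *\<^sub>v v) $ i) \<le> (\<Sum>j<n. cmod (A $$ (i, j) * v $ j))" by (simp add: norm_sum)
    also have "\<dots> \<le> (\<Sum>j<n. c * cmod (v $ j))"
      using c i by (auto simp: norm_mult intro!: sum_mono mult_right_mono)
    finally have "cmod ((A *\<^sub>v v) $ i) \<le> c * ?S" by (simp add: sum_distrib_left)
    then show ?thesis unfolding power_mult_distrib[symmetric] by (intro power_mono) auto
  qed
  have "(\<Sum>i<n. (cmod ((A *\<^sub>v v) $ i))\<^sup>2) \<le> (\<Sum>i<n. c\<^sup>2 * ?S\<^sup>2)" using row by (intro sum_mono) auto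
  also have "\<dots> \<le> real n * (c\<^sup>2 * real n)"
    using sum_norm_le_euclidean_norm[OF v(1)] by (auto simp: v(2) intro!: mult_left_mono)
  also have "\<dots> = (real n * c)\<^sup>2" by (simp add: power2_eq_square)
  finally have "euclidean_norm_vec (A *\<^sub>v v) \<le> sqrt ((real n * c)\<^sup>2)"
    unfolding euclidean_norm_vec_eq[OF Av] by (rule real_sqrt_le_mono)
  then show "euclidean_norm_vec (A *\<^sub>v v) \<le> real n * c" using c0 by simp
qed

lemma pos_semidef_gram_mat:
  fixes f :: "nat \<Rightarrow> 'w \<Rightarrow> complex"
  assumes int: "\<And>i j. i < n \<Longrightarrow> j < n \<Longrightarrow> integrable \<mu> (\<lambda>w. f i w * cnj (f j w))"
  shows "pos_semidef (Matrix.mat n n (\<lambda>(i, j). LINT w|\<mu>. f i w * cnj (f j w)))" (is "pos_semidef ?A")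
  unfolding pos_semidef_def
proof (intro conjI ballI)
  have A: "?A \<in> carrier_mat n n" by simp
  show "hermitian_mat ?A"
    by (rule hermitian_matI[OF A]) (simp add: mult.commute flip: Bochner_Integration.integral_cnj)
  fix v :: "complex vec" assume "v \<in> carrier_vec (dim_row ?A)"
  then have v: "v \<in> carrier_vec n" by simp
  \<comment> \<open>The conjugate sits on \<open>v $ i\<close> because the form pairs
    \<open>f i\<close> with \<open>cnj (v $ i)\<close>; the integrand of the form then becomes the
    squared modulus of \<open>h\<close>.\<close>
  define h where "h w = (\<Sum>i<n. cnj (v $ i) * f i w)" for w
  define t where "t i j w = f i w * cnj (f j w) * v $ j * cnj (v $ i)" for i j w
  have t: "integrable \<mu> (t i j)" if "i < n" "j < n" for i j
    unfolding t_def[abs_def] using int[OF that] by (intro integrable_mult_left impI)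
  have "(?A *\<^sub>v v) \<bullet>c v = (\<Sum>i<n. \<Sum>j<n. (LINT w|\<mu>. f i w * cnj (f j w)) * v $ j * cnj (v $ i))"
    unfolding quadratic_form_sum[OF A v] by (intro sum.cong refl) simp
  also have "\<dots> = (\<Sum>i<n. \<Sum>j<n. integral\<^sup>L \<mu> (t i j))"
    by (simp add: t_def[abs_def])
  also have "\<dots> = (\<Sum>i<n. LINT w|\<mu>. (\<Sum>j<n. t i j w))"
    using t by (intro sum.cong refl Bochner_Integration.integral_sum[symmetric]) auto
  also have "\<dots> = (LINT w|\<mu>. (\<Sum>i<n. \<Sum>j<n. t i j w))"
    using t by (intro Bochner_Integration.integral_sum[symmetric] Bochner_Integration.integrable_sum) auto
  also have "(\<lambda>w. \<Sum>i<n. \<Sum>j<n. t i j w) = (\<lambda>w. complex_of_real ((cmod (h w))\<^sup>2))"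
    unfolding complex_norm_square h_def t_def cnj_sum sum_product
    by (intro ext sum.cong refl) (simp add: mult_ac)
  also have "(LINT w|\<mu>. complex_of_real ((cmod (h w))\<^sup>2)) = complex_of_real (LINT w|\<mu>. (cmod (h w))\<^sup>2)" by (rule integral_complex_of_real)
  finally show "0 \<le> Re ((?A *\<^sub>v v) \<bullet>c v)" by (simp only: Re_complex_of_real) simp
qed

section \<open>From the entrywise error to eigenvalues, spectral norm and Loewner bounds\<close>

theorem theorem2p1:
  fixes \<mu> :: "'w::topological_space measure"
    and X :: "'x set"
    and G :: "'w \<Rightarrow> 'x \<Rightarrow> complex"
    and V :: "('w \<Rightarrow> complex) set"
    and \<nu> :: "'w set \<Rightarrow> real"
    and M N :: nat
    and w :: "nat \<Rightarrow> 'w"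
    and x :: "nat \<Rightarrow> 'x"
    and normG epsV eps :: real
    and KK KKhat :: "complex mat"
    and \<sigma> \<tau> :: "real list"
  assumes "sets \<mu> = sets borel" and "sigma_finite_measure \<mu>"
    and "X \<noteq> {}"
    and "\<And>y. y \<in> X \<Longrightarrow> (\<lambda>w. G w y) \<in> borel_measurable \<mu>"
    and "(\<lambda>y w. G w y) ` X \<subseteq> L1C0_space \<mu>"
    and "compactin (L1C0_topology \<mu>) ((\<lambda>y w. G w y) ` X)"
    and "M \<ge> 1" and "N \<ge> 1"
    and "V \<subseteq> L1C0_space \<mu>" and "complex_fun_subspace V"
    and "quadrature_measure \<mu> V \<nu>"
    and "signed_support \<nu> = w ` {..<N}"
    and "\<And>y. y \<in> X \<Longrightarrow> L1C0_norm \<mu> (\<lambda>w. G w y) \<le> normG"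
    and "\<And>y. y \<in> X \<Longrightarrow> L1C0_setdist \<mu> (\<lambda>w. G w y) V \<le> epsV"
    and "\<And>k. k < M \<Longrightarrow> x k \<in> X"
    and "KK = Matrix.mat M M (\<lambda>(k, j). integral_kernel \<mu> G (x k) (x j))"
    and "KKhat = Matrix.mat M M (\<lambda>(k, j). signed_kernel \<nu> G (x k) (x j))"
    and "\<sigma> = ordered_eigenvalues KK" and "\<tau> = ordered_eigenvalues KKhat"
    and "eps = 4 * (1 + total_variation \<nu>) * real M * normG * epsV"
  shows "(MAX j\<in>{..<M}. \<bar>\<sigma> ! j - \<tau> ! j\<bar>) \<le> eps \<and>
    spectral_norm (KK - KKhat) \<le> eps \<and>
    (\<forall>\<Lambda>\<ge>eps.
      KK - complex_of_real \<Lambda> \<cdot>\<^sub>m 1\<^sub>m M \<lless> KKhat \<and>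
      KKhat \<lless> KK + complex_of_real \<Lambda> \<cdot>\<^sub>m 1\<^sub>m M) \<and>
    (\<forall>lam>0. \<forall>\<Delta>\<ge>eps / (lam + \<sigma> ! (M - 1)).
      complex_of_real (1 - \<Delta>) \<cdot>\<^sub>m (KK + complex_of_real lam \<cdot>\<^sub>m 1\<^sub>m M)
        \<lless> KKhat + complex_of_real lam \<cdot>\<^sub>m 1\<^sub>m M \<and>
      KKhat + complex_of_real lam \<cdot>\<^sub>m 1\<^sub>m M
        \<lless> complex_of_real (1 + \<Delta>) \<cdot>\<^sub>m (KK + complex_of_real lam \<cdot>\<^sub>m 1\<^sub>m M))"
proof -
  note \<mu> = assms(1) and V = assms(9,10) and q = assms(11) and K = assms(16) and Kh = assms(17)
  note x = assms(15) and \<sigma> = assms(18) and \<tau> = assms(19) and eps = assms(20)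
  have GX: "(\<lambda>w. G w (x k)) \<in> L1C0_space \<mu>" if "k < M" for k using assms(5) x[OF that] by auto
  have ia: "integrable \<mu> (\<lambda>w. G w (x i) * cnj (G w (x j)))" if "i < M" "j < M" for i j
    using GX[OF that(1)] GX[OF that(2)] by (intro integrable_mult_cnj[OF \<mu>]) (auto simp: L1C0_space_def)
  note T0 = total_variation_nonneg[of \<nu>]
  define c where "c = 3 * (1 + total_variation \<nu>) * normG * epsV"
  have entry: "cmod (integral_kernel \<mu> G (x i) (x j) - signed_kernel \<nu> G (x i) (x j)) \<le> c"
    and e0: "0 \<le> epsV" if "i < M" "j < M" for i j
    unfolding integral_kernel_def signed_kernel_def c_def
    using kernel_quadrature_error[OF \<mu> V q GX[OF that(1)] GX[OF that(2)] assms(13)[OF x[OF that(1)]]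
        assms(13)[OF x[OF that(2)]] assms(14)[OF x[OF that(1)]] assms(14)[OF x[OF that(2)]]] by auto
  \<comment> \<open>The signs of \<open>epsV\<close> and \<open>normG\<close> are not hypotheses;
    they are read off at the point \<open>x 0\<close>, which exists because M \<ge> 1.\<close>
  have "0 \<le> epsV" using e0[of 0 0] assms(7) by simp
  moreover have "0 \<le> normG"
    using assms(13)[OF x[of 0]] assms(7) L1C0_norm_nonneg[of \<mu> "\<lambda>w. G w (x 0)"] by simp
  moreover define p where "p = (1 + total_variation \<nu>) * normG * epsV"
  ultimately have p0: "0 \<le> p" using T0 by simp
  have c_eq: "c = 3 * p" and eps_eq: "eps = 4 * (real M * p)"
    unfolding c_def eps p_def by (simp_all only: mult_ac)
  have c0: "0 \<le> c" using p0 by (simp add: c_eq)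
  have "0 \<le> real M * p" using p0 by simp
  \<comment> \<open>The slack between 3 M p and 4 M p is given away here.\<close>
  then have ceps: "real M * c \<le> eps" unfolding c_eq eps_eq by linarith
  have eps0: "0 \<le> eps" using ceps c0 by (meson mult_nonneg_nonneg of_nat_0_le_iff order_trans)
  have KC: "KK \<in> carrier_mat M M" and KhC: "KKhat \<in> carrier_mat M M" by (simp_all add: K Kh)
  have DC: "KK - KKhat \<in> carrier_mat M M" by (rule minus_carrier_mat[OF KhC])
  have Kpsd: "pos_semidef KK"
    unfolding K integral_kernel_def using ia by (rule pos_semidef_gram_mat)
  then have hK: "hermitian_mat KK" by (simp add: pos_semidef_def)
  have hKh: "hermitian_mat KKhat"
  proof (rule hermitian_matI[OF KhC])
    fix i j assume "i < M" "j < M"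
    then show "KKhat $$ (i, j) = cnj (KKhat $$ (j, i))"
      by (simp add: Kh signed_kernel_def signed_integral_def mult.commute flip: Bochner_Integration.integral_cnj)
  qed
  have D: "cmod ((KK - KKhat) $$ (i, j)) \<le> c" if "i < M" "j < M" for i j
    using entry[OF that] that by (simp add: K Kh)
  have quad: "\<bar>Re ((KK *\<^sub>v v) \<bullet>c v) - Re ((KKhat *\<^sub>v v) \<bullet>c v)\<bar> \<le> eps * Re (v \<bullet>c v)"
    if "v \<in> carrier_vec M" for v
  proof -
    have "\<bar>Re (((KK - KKhat) *\<^sub>v v) \<bullet>c v)\<bar> \<le> real M * c * Re (v \<bullet>c v)"
      using quadratic_form_le_of_entries_le[OF DC D c0 that] .
    also have "\<dots> \<le> eps * Re (v \<bullet>c v)"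
      using ceps by (intro mult_right_mono) (simp_all add: Re_cscalar_prod_self)
    finally show ?thesis by (simp only: Re_quadratic_form_minus[OF KC KhC that])
  qed
  have s0: "0 \<le> Re (v \<bullet>c v)" for v :: "complex vec" by (simp add: Re_cscalar_prod_self)
  \<comment> \<open>The form inequality is symmetric in the two matrices, so the one-sided
    comparison is applied in both directions.\<close>
  have "\<bar>\<sigma> ! j - \<tau> ! j\<bar> \<le> eps" if "j < M" for j
  proof -
    have "Re ((KK *\<^sub>v v) \<bullet>c v) \<le> Re ((KKhat *\<^sub>v v) \<bullet>c v) + eps * Re (v \<bullet>c v)"
      "Re ((KKhat *\<^sub>v v) \<bullet>c v) \<le> Re ((KK *\<^sub>v v) \<bullet>c v) + eps * Re (v \<bullet>c v)"
      if "v \<in> carrier_vec M" for v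
      using quad[OF that] by linarith+
    then have "\<sigma> ! j \<le> \<tau> ! j + eps" "\<tau> ! j \<le> \<sigma> ! j + eps"
      unfolding \<sigma> \<tau>
      using eigenvalue_le_of_quadratic_form_le[OF KC hK KhC hKh _ that, of eps]
        eigenvalue_le_of_quadratic_form_le[OF KhC hKh KC hK _ that, of eps] by blast+
    then show ?thesis by simp
  qed
  then have 1: "(MAX j\<in>{..<M}. \<bar>\<sigma> ! j - \<tau> ! j\<bar>) \<le> eps"
    using assms(7) by (intro Max.boundedI) (auto simp: lessThan_empty_iff)
  have 2: "spectral_norm (KK - KKhat) \<le> eps"
    using spectral_norm_le_of_entries_le[OF DC D c0 assms(7)] ceps by simp
  have IC: "complex_of_real r \<cdot>\<^sub>m 1\<^sub>m M \<in> carrier_mat M M" for r by simp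
  have hI: "hermitian_mat (complex_of_real r \<cdot>\<^sub>m 1\<^sub>m M)" for r
    by (rule hermitian_mat_smult[OF one_carrier_mat hermitian_mat_one])
  have form_I: "Re ((complex_of_real r \<cdot>\<^sub>m 1\<^sub>m M *\<^sub>v v) \<bullet>c v) = r * Re (v \<bullet>c v)"
    if "v \<in> carrier_vec M" for r v
    using that by (simp add: quadratic_form_smult[OF one_carrier_mat that])
  have 3: "KK - complex_of_real \<Lambda> \<cdot>\<^sub>m 1\<^sub>m M \<lless> KKhat \<and> KKhat \<lless> KK + complex_of_real \<Lambda> \<cdot>\<^sub>m 1\<^sub>m M"
    if "eps \<le> \<Lambda>" for \<Lambda>
  proof -
    have "\<bar>Re ((KK *\<^sub>v v) \<bullet>c v) - Re ((KKhat *\<^sub>v v) \<bullet>c v)\<bar> \<le> \<Lambda> * Re (v \<bullet>c v)"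
      if "v \<in> carrier_vec M" for v
      using quad[OF that] mult_right_mono[OF \<open>eps \<le> \<Lambda>\<close> s0[of v]] by simp
    then have le: "Re ((KK *\<^sub>v v) \<bullet>c v) - \<Lambda> * Re (v \<bullet>c v) \<le> Re ((KKhat *\<^sub>v v) \<bullet>c v)"
      "Re ((KKhat *\<^sub>v v) \<bullet>c v) \<le> Re ((KK *\<^sub>v v) \<bullet>c v) + \<Lambda> * Re (v \<bullet>c v)"
      if "v \<in> carrier_vec M" for v using that by (fastforce simp: abs_le_iff)+
    have "KK - complex_of_real \<Lambda> \<cdot>\<^sub>m 1\<^sub>m M \<lless> KKhat"
      by (rule loewner_leI[OF minus_carrier_mat[OF IC] KhC hermitian_mat_minus[OF KC IC hK hI] hKh])
        (simp only: Re_quadratic_form_minus[OF KC IC] form_I le)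
    moreover have "KKhat \<lless> KK + complex_of_real \<Lambda> \<cdot>\<^sub>m 1\<^sub>m M"
      by (rule loewner_leI[OF KhC add_carrier_mat[OF IC] hKh hermitian_mat_add[OF KC IC hK hI]])
        (simp only: Re_quadratic_form_add_identity[OF KC] le)
    ultimately show ?thesis ..
  qed
  have 4: "complex_of_real (1 - \<Delta>) \<cdot>\<^sub>m (KK + complex_of_real lam \<cdot>\<^sub>m 1\<^sub>m M)
        \<lless> KKhat + complex_of_real lam \<cdot>\<^sub>m 1\<^sub>m M \<and>
      KKhat + complex_of_real lam \<cdot>\<^sub>m 1\<^sub>m M
        \<lless> complex_of_real (1 + \<Delta>) \<cdot>\<^sub>m (KK + complex_of_real lam \<cdot>\<^sub>m 1\<^sub>m M)"
    if lam: "0 < lam" and \<Delta>: "eps / (lam + \<sigma> ! (M - 1)) \<le> \<Delta>" for lam \<Delta>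
  proof -
    \<comment> \<open>Indices start at 0, so this is \<sigma>_M. Its sign allows the hypothesis on
      \<Delta> to be multiplied by the denominator.\<close>
    have "0 \<le> \<sigma> ! (M - 1)"
      unfolding \<sigma> using assms(7) by (intro ordered_eigenvalues_nonneg[OF KC Kpsd]) simp
    then have pos: "0 < lam + \<sigma> ! (M - 1)" using lam by simp
    have \<Delta>eps: "eps \<le> \<Delta> * (lam + \<sigma> ! (M - 1))" using \<Delta> pos by (simp add: pos_divide_le_eq)
    have \<Delta>0: "0 \<le> \<Delta>" using \<Delta> eps0 pos by (meson divide_nonneg_pos order_trans)
    let ?K = "KK + complex_of_real lam \<cdot>\<^sub>m 1\<^sub>m M" and ?Kh = "KKhat + complex_of_real lam \<cdot>\<^sub>m 1\<^sub>m M"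
    have C: "?K \<in> carrier_mat M M" "?Kh \<in> carrier_mat M M" by simp_all
    have h: "hermitian_mat ?K" "hermitian_mat ?Kh"
      by (rule hermitian_mat_add[OF KC IC hK hI], rule hermitian_mat_add[OF KhC IC hKh hI])
    have form: "Re (((complex_of_real r \<cdot>\<^sub>m ?K) *\<^sub>v v) \<bullet>c v) = r * (Re ((KK *\<^sub>v v) \<bullet>c v) + lam * Re (v \<bullet>c v))"
      if "v \<in> carrier_vec M" for r v
      unfolding quadratic_form_smult[OF C(1) that] Re_quadratic_form_add_identity[OF KC that, symmetric] by simp
    \<comment> \<open>This turns the absolute error into a relative one: the form of the regularised
      matrix is at least (lam + \<sigma>_M) times the squared length.\<close>
    have le: "eps * Re (v \<bullet>c v) \<le> \<Delta> * (Re ((KK *\<^sub>v v) \<bullet>c v) + lam * Re (v \<bullet>c v))"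
      if "v \<in> carrier_vec M" for v
    proof -
      have "eps * Re (v \<bullet>c v) \<le> \<Delta> * (lam + \<sigma> ! (M - 1)) * Re (v \<bullet>c v)"
        using \<Delta>eps s0 by (rule mult_right_mono)
      also have "\<dots> = \<Delta> * (\<sigma> ! (M - 1) * Re (v \<bullet>c v) + lam * Re (v \<bullet>c v))" by (simp add: algebra_simps)
      also have "\<dots> \<le> \<Delta> * (Re ((KK *\<^sub>v v) \<bullet>c v) + lam * Re (v \<bullet>c v))"
        unfolding \<sigma> using least_eigenvalue_le_quadratic_form[OF KC hK assms(7) that] \<Delta>0
        by (intro mult_left_mono add_right_mono)
      finally show ?thesis .
    qed
    have "complex_of_real (1 - \<Delta>) \<cdot>\<^sub>m ?K \<lless> ?Kh"
    proof (rule loewner_leI[OF smult_carrier_mat[OF C(1)] C(2) hermitian_mat_smult[OF C(1) h(1)] h(2)])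
      fix v :: "complex vec" assume v: "v \<in> carrier_vec M"
      show "Re (((complex_of_real (1 - \<Delta>) \<cdot>\<^sub>m ?K) *\<^sub>v v) \<bullet>c v) \<le> Re ((?Kh *\<^sub>v v) \<bullet>c v)"
        unfolding form[OF v] Re_quadratic_form_add_identity[OF KhC v]
        using quad[OF v] le[OF v] by (auto simp: abs_le_iff left_diff_distrib)
    qed
    moreover have "?Kh \<lless> complex_of_real (1 + \<Delta>) \<cdot>\<^sub>m ?K"
    proof (rule loewner_leI[OF C(2) smult_carrier_mat[OF C(1)] h(2) hermitian_mat_smult[OF C(1) h(1)]])
      fix v :: "complex vec" assume v: "v \<in> carrier_vec M"
      show "Re ((?Kh *\<^sub>v v) \<bullet>c v) \<le> Re (((complex_of_real (1 + \<Delta>) \<cdot>\<^sub>m ?K) *\<^sub>v v) \<bullet>c v)"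
        unfolding form[OF v] Re_quadratic_form_add_identity[OF KhC v]
        using quad[OF v] le[OF v] by (auto simp: abs_le_iff distrib_right)
    qed
    ultimately show ?thesis ..
  qed
  from 1 2 3 4 show ?thesis by blast
qed

end
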